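(* Let $p$ be a prime, let $e\geq 1$, and let $G\cong\mathbb{Z}_p^{r_1}\oplus\mathbb{Z}_{p^2}^{r_2}\oplus\cdots\oplus\mathbb{Z}_{p^e}^{r_e}$ be a non-trivial abelian $p$-group such that $r_i\geq p-1$ for $1\leq i\leq e-1$, and $r_e\geq\max\{p-2,1\}$. (a) The reduced minimum genus $\mu_0(G)$ and the reduced stable upper genus $\sigma_0(G)$ are given by $$\mu_0(G)=\sigma_0(G)=\frac12\cdot\Big(-1-p^e+\sum_{i=1}^e(p^e-p^{e-i})\cdot r_i\Big).$$ (b) Let $0\leq j\leq e$ be smallest such that $(r_{j+1},\dots,r_e)=(p-1,\dots,p-1)$, where $j=e$ refers to the case $r_e\neq p-1$. Then the $p$-data $(x_1,\dots,x_e;h)\in D(G)$ with $g_0(x_1,\dots,x_e;h)=\mu_0(G)$ are precisely $$\Big(r_1,\dots,r_{i-1},r_i+1,0,\dots,0;\tfrac12(e-i)(p-1)\Big),$$ where $j\leq i\leq e$ is arbitrary if $p$ is odd, and where $j\leq i\leq e$ is restricted to the cases with $e-i$ even if $p=2$ (for $i=0$ the datum is read as $(0,\dots,0;\frac12 e(p-1))$). In particular $\mu_0(G)$ is always afforded by $(r_1,\dots,r_{e-1},r_e+1;0)$.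
   Context: $\mathbb{Z}_n$ is the cyclic group of order $n$; $\mathbb{N}_0=\{0,1,2,\dots\}$. A finite group $G$ acts on a compact Riemann surface $X$ if $G$ embeds into the group of biholomorphic self-maps of $X$. The spectrum $\mathrm{sp}(G)$ is the set of all $g\geq 0$ such that $G$ acts on some compact Riemann surface of genus $g$. Put $\Delta(G)=|G|/\exp(G)$, and let the reduced spectrum be $\mathrm{sp}_0(G)=\{(g-1)/\Delta(G): g\in\mathrm{sp}(G)\}\subset\mathbb{Q}$. The reduced minimum genus is $\mu_0(G)=\min\mathrm{sp}_0(G)$. For a non-trivial finite $p$-group $G$ let $\epsilon(G)=1$ if $p$ is odd; if $p=2$ let $\epsilon(G)=1$ if $\{a\in G:|a|<\exp(G)\}$ is a subgroup of index $2$ in $G$, and $\epsilon(G)=2$ otherwise. Put $\mathbb{S}=\frac{1}{\epsilon(G)}(\{-1\}\cup\mathbb{N}_0)$; one has $\mathrm{sp}_0(G)\subseteq\mathbb{S}$ with finite complement. The reduced stable upper genus $\sigma_0(G)$ is the smallest element of $\mathbb{S}$ such that all elements of $\mathbb{S}\setminus\mathrm{sp}_0(G)$ are less than $\sigma_0(G)$. $p$-data: let $G$ be a finite $p$-group of exponent $p^e$. For $(x_1,\dots,x_e;h)\in\mathbb{N}_0^{e+1}$ let $\Gamma$ be the group generated by $a_k,b_k$ ($1\leq k\leq h$) and $c_{ij}$ ($1\leq i\leq e$, $1\leq j\leq x_i$) with relations $c_{ij}^{p^i}=1$ and $\prod_{k}[a_k,b_k]\cdot\prod_{i=1}^e\prod_{j=1}^{x_i}c_{ij}=1$.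 An epimorphism $\phi:\Gamma\to G$ is smooth if $\phi(c_{ij})$ has order exactly $p^i$ for all $i,j$. The data spectrum $D(G)$ is the set of all $(x_1,\dots,x_e;h)$ for which a smooth epimorphism $\Gamma\to G$ exists; its elements are the $p$-data of $G$. The reduced genus map is $g_0(x_1,\dots,x_e;h)=(h-1)p^e+\frac12\sum_{i=1}^e x_i(p^e-p^{e-i})$. By the standard correspondence between group actions and smooth epimorphisms together with the Riemann-Hurwitz formula, $\mathrm{sp}_0(G)=g_0(D(G))$. A $p$-datum is said to afford a reduced genus if $g_0$ maps it to that reduced genus. *)

theory Defs
  imports "HOL-Complex_Analysis.Complex_Analysis" "HOL-Homology.Homology"
    "HOL-Algebra.Bij" "HOL-Algebra.Multiplicative_Group" "HOL-Algebra.Free_Abelian_Groups"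
begin

section \<open>Compact Riemann surfaces and their automorphism groups\<close>

type_synonym 'a chart = "'a set \<times> ('a \<Rightarrow> complex)"

definition complex_atlas :: "'a topology \<Rightarrow> 'a chart set \<Rightarrow> bool" where
  "complex_atlas X A \<longleftrightarrow>
     (\<Union>(U, \<phi>)\<in>A. U) = topspace X \<and>
     (\<forall>(U, \<phi>)\<in>A. openin X U \<and> open (\<phi> ` U) \<and>
        homeomorphic_map (subtopology X U) (top_of_set (\<phi> ` U)) \<phi>) \<and>
     (\<forall>(U, \<phi>)\<in>A. \<forall>(V, \<psi>)\<in>A. (\<psi> \<circ> inv_into U \<phi>) holomorphic_on \<phi> ` (U \<inter> V))"

definition compact_riemann_surface :: "'a topology \<Rightarrow> 'a chart set \<Rightarrow> bool" where
  "compact_riemann_surface X A \<longleftrightarrow>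
     topspace X \<noteq> {} \<and> Hausdorff_space X \<and> compact_space X \<and> connected_space X \<and>
     complex_atlas X A"

definition holomorphic_self_map :: "'a topology \<Rightarrow> 'a chart set \<Rightarrow> ('a \<Rightarrow> 'a) \<Rightarrow> bool" where
  "holomorphic_self_map X A f \<longleftrightarrow>
     continuous_map X X f \<and>
     (\<forall>(U, \<phi>)\<in>A. \<forall>(V, \<psi>)\<in>A.
        (\<psi> \<circ> f \<circ> inv_into U \<phi>) holomorphic_on \<phi> ` {x \<in> U. f x \<in> V})"

definition biholomorphic_group :: "'a topology \<Rightarrow> 'a chart set \<Rightarrow> ('a \<Rightarrow> 'a) monoid" where
  "biholomorphic_group X A =
     (BijGroup (topspace X))
       \<lparr>carrier := {f \<in> Bij (topspace X). holomorphic_self_map X A f \<and>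
          holomorphic_self_map X A (restrict (inv_into (topspace X) f) (topspace X))}\<rparr>"

definition acts_on_surface :: "('g, 'm) monoid_scheme \<Rightarrow> 'a topology \<Rightarrow> 'a chart set \<Rightarrow> bool" where
  "acts_on_surface G X A \<longleftrightarrow> mon G (biholomorphic_group X A) \<noteq> {}"

(* For a compact Riemann surface X, this determines g: the first homology group is free
   abelian of rank 2g. *)
definition has_genus :: "'a topology \<Rightarrow> nat \<Rightarrow> bool" where
  "has_genus X g \<longleftrightarrow> homology_group 1 X \<cong> free_Abelian_group {..<2 * g}"


section \<open>The genus spectrum and the reduced spectrum\<close>

(* The points of X are taken from the type complex.  No surface is lost, since every compact
   Riemann surface has the cardinality of the continuum; the topology of X is unrelated to
   the standard one on the complex numbers. *)
definition genus_spectrum :: "('g, 'm) monoid_scheme \<Rightarrow> nat set" where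
  "genus_spectrum G =
     {g. \<exists>(X :: complex topology) A.
           compact_riemann_surface X A \<and> has_genus X g \<and> acts_on_surface G X A}"

definition group_exponent :: "('g, 'm) monoid_scheme \<Rightarrow> nat" where
  "group_exponent G = (LEAST n. 0 < n \<and> (\<forall>a\<in>carrier G. a [^]\<^bsub>G\<^esub> n = \<one>\<^bsub>G\<^esub>))"

definition group_Delta :: "('g, 'm) monoid_scheme \<Rightarrow> rat" where
  "group_Delta G = of_nat (order G) / of_nat (group_exponent G)"

definition reduced_spectrum :: "('g, 'm) monoid_scheme \<Rightarrow> rat set" where
  "reduced_spectrum G = (\<lambda>g. (of_nat g - 1) / group_Delta G) ` genus_spectrum G"

definition reduced_minimum_genus :: "('g, 'm) monoid_scheme \<Rightarrow> rat" where
  "reduced_minimum_genus G = (LEAST s. s \<in> reduced_spectrum G)"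

(* In the next three definitions G is meant to be a non-trivial finite p-group. *)
definition group_epsilon :: "nat \<Rightarrow> ('g, 'm) monoid_scheme \<Rightarrow> nat" where
  "group_epsilon p G =
     (let H = {a \<in> carrier G. group.ord G a < group_exponent G}
      in if odd p \<or> (subgroup H G \<and> card (rcosets\<^bsub>G\<^esub> H) = 2) then 1 else 2)"

definition genus_range :: "nat \<Rightarrow> ('g, 'm) monoid_scheme \<Rightarrow> rat set" where
  "genus_range p G = (\<lambda>s. s / of_nat (group_epsilon p G)) ` ({-1} \<union> range of_nat)"

definition reduced_stable_upper_genus :: "nat \<Rightarrow> ('g, 'm) monoid_scheme \<Rightarrow> rat" where
  "reduced_stable_upper_genus p G =
     (LEAST s. s \<in> genus_range p G \<and> (\<forall>t \<in> genus_range p G - reduced_spectrum G. t < s))"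


section \<open>Groups given by generators and relators\<close>

(* A letter (x, True) stands for the generator x, a letter (x, False) for its inverse. *)
type_synonym 'x word = "('x \<times> bool) list"

definition words :: "'x set \<Rightarrow> 'x word set" where
  "words S = lists (S \<times> UNIV)"

inductive word_equiv :: "'x set \<Rightarrow> 'x word set \<Rightarrow> 'x word \<Rightarrow> 'x word \<Rightarrow> bool" for S R where
  refl: "u \<in> words S \<Longrightarrow> word_equiv S R u u"
| sym: "word_equiv S R u v \<Longrightarrow> word_equiv S R v u"
| trans: "word_equiv S R u v \<Longrightarrow> word_equiv S R v w \<Longrightarrow> word_equiv S R u w"
| cancel: "u \<in> words S \<Longrightarrow> v \<in> words S \<Longrightarrow> x \<in> S \<Longrightarrow>
     word_equiv S R (u @ [(x, b), (x, \<not> b)] @ v) (u @ v)"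
| relator: "u \<in> words S \<Longrightarrow> v \<in> words S \<Longrightarrow> r \<in> R \<Longrightarrow> word_equiv S R (u @ r @ v) (u @ v)"

definition word_class :: "'x set \<Rightarrow> 'x word set \<Rightarrow> 'x word \<Rightarrow> 'x word set" where
  "word_class S R u = {v. word_equiv S R u v}"

(* Meant for relators R that are words over S. *)
definition presented_group :: "'x set \<Rightarrow> 'x word set \<Rightarrow> 'x word set monoid" where
  "presented_group S R =
     \<lparr>carrier = word_class S R ` words S,
      mult = (\<lambda>A B. \<Union>u\<in>A. \<Union>v\<in>B. word_class S R (u @ v)),
      one = word_class S R []\<rparr>"


section \<open>Data spectrum and reduced genus map\<close>

datatype generator = GenA nat | GenB nat | GenC nat nat

(* A tuple (x_1, ..., x_e; h) is the pair (x, h), where x is a function that vanishes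
   outside {1..e}. *)
type_synonym p_datum = "(nat \<Rightarrow> nat) \<times> nat"

definition Gamma_generators :: "nat \<Rightarrow> p_datum \<Rightarrow> generator set" where
  "Gamma_generators e = (\<lambda>(x, h).
     GenA ` {1..h} \<union> GenB ` {1..h} \<union> {GenC i j | i j. i \<in> {1..e} \<and> j \<in> {1..x i}})"

definition long_relator :: "nat \<Rightarrow> p_datum \<Rightarrow> generator word" where
  "long_relator e = (\<lambda>(x, h).
     concat (map (\<lambda>k. [(GenA k, True), (GenB k, True), (GenA k, False), (GenB k, False)])
               [1..<Suc h]) @
     concat (map (\<lambda>i. map (\<lambda>j. (GenC i j, True)) [1..<Suc (x i)]) [1..<Suc e]))"

definition Gamma_relators :: "nat \<Rightarrow> nat \<Rightarrow> p_datum \<Rightarrow> generator word set" where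
  "Gamma_relators p e d =
     {replicate (p ^ i) (GenC i j, True) | i j. i \<in> {1..e} \<and> j \<in> {1..fst d i}} \<union>
     {long_relator e d}"

definition Gamma_group :: "nat \<Rightarrow> nat \<Rightarrow> p_datum \<Rightarrow> generator word set monoid" where
  "Gamma_group p e d = presented_group (Gamma_generators e d) (Gamma_relators p e d)"

definition Gamma_c :: "nat \<Rightarrow> nat \<Rightarrow> p_datum \<Rightarrow> nat \<Rightarrow> nat \<Rightarrow> generator word set" where
  "Gamma_c p e d i j =
     word_class (Gamma_generators e d) (Gamma_relators p e d) [(GenC i j, True)]"

definition smooth_epi ::
  "nat \<Rightarrow> nat \<Rightarrow> p_datum \<Rightarrow> ('g, 'm) monoid_scheme \<Rightarrow> (generator word set \<Rightarrow> 'g) \<Rightarrow> bool" where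
  "smooth_epi p e d G \<phi> \<longleftrightarrow>
     \<phi> \<in> epi (Gamma_group p e d) G \<and>
     (\<forall>i\<in>{1..e}. \<forall>j\<in>{1..fst d i}. group.ord G (\<phi> (Gamma_c p e d i j)) = p ^ i)"

(* Here G is meant to be a finite p-group of exponent p ^ e. *)
definition data_spectrum :: "nat \<Rightarrow> nat \<Rightarrow> ('g, 'm) monoid_scheme \<Rightarrow> p_datum set" where
  "data_spectrum p e G =
     {d. (\<forall>i. i \<notin> {1..e} \<longrightarrow> fst d i = 0) \<and> (\<exists>\<phi>. smooth_epi p e d G \<phi>)}"

definition reduced_genus :: "nat \<Rightarrow> nat \<Rightarrow> p_datum \<Rightarrow> rat" where
  "reduced_genus p e = (\<lambda>(x, h).
     (of_nat h - 1) * of_nat p ^ e +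
     1 / 2 * (\<Sum>i = 1..e. of_nat (x i) * (of_nat p ^ e - of_nat p ^ (e - i))))"

end

theory Submission
  imports Defs
begin

text \<open>
  Since G is abelian, a smooth epimorphism onto G is a choice of images of the generators such
  that the images of the c_ij have the prescribed orders and product 1, and all images together
  generate G. Reducing modulo p the coordinates in the cyclic factors of order larger than p^m
  kills the c_ij with i <= m. Hence R(m) <= 2h + X(m) for the tail sums
  R(m) = r_{m+1} + ... + r_e and X(m) = x_{m+1} + ... + x_e, with strict inequality if X(m) > 0
  because of the product relation. Let m be the largest index with x_m > 0. Summation by parts
  turns twice the excess of g_0 over the asserted minimum into the sum over i <= m of
  (X(i-1) + 2h - R(i-1) - 1) p^(e-i) (p-1), plus (2h - R(m)) p^(e-m), plus the sum over l > m of
  (r_l - (p-1)) p^(e-l). Only the summand for l = e can be negative, and only if r_e = p - 2;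
  then the parity of 2h keeps the total positive.

  Conversely, an admissible excess is written as 2h + (p-1) M with 2h < p-1, and the base-p
  digits of M prescribe a datum with x_e >= 2. It is realized by matching each basis element of G
  not covered by the a_k, b_k with a c_ij of at least its order, and by correcting orders with
  multiples of one basis element of maximal order.
\<close>

section \<open>Words in the presentation\<close>

text \<open>Both rank hypotheses are digit conditions. The slacks z_i = X(i-1) + 2h - R(i-1) - 1
  determine a datum through x_i = z_i + r_i - z_{i+1} for i < e, and r_i \<ge> p - 1 keeps this
  nonnegative for all digits z_{i+1} < p. For odd p, 2h is an even number below the even number p -
  1, hence at most p - 3, so r_e \<ge> p - 2 leaves a basis element of order p^e to the c_ij. The
  delicate point of the construction is that all orders are prescribed exactly while one c is forced
  by the product relation. That c is taken at the top level. Its order is right as soon as the sum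
  of the others has a coordinate prime to p in a factor of top order. A second uncovered basis
  element of top order provides one. With only one such element, the other images are adjusted by
  units modulo p. This works for odd p; for p = 2 every unit is 1 modulo p, so the number of c at
  the top level has to be even. For p = 2 and r_e = 1 this parity matches the coarser lattice
  prescribed by epsilon = 1.\<close>

definition word_sum :: "('x \<Rightarrow> 'i \<Rightarrow> int) \<Rightarrow> 'x word \<Rightarrow> 'i \<Rightarrow> int" where
  "word_sum f w q = (\<Sum>(x, b)\<leftarrow>w. if b then f x q else - f x q)"

lemma word_sum_Nil [simp]: "word_sum f [] = (\<lambda>q. 0)"
  by (simp add: word_sum_def fun_eq_iff)

lemma word_sum_Cons [simp]:
  "word_sum f ((x, b) # w) = (\<lambda>q. (if b then f x q else - f x q) + word_sum f w q)"
  by (simp add: word_sum_def fun_eq_iff)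

lemma word_sum_append [simp]: "word_sum f (u @ v) = (\<lambda>q. word_sum f u q + word_sum f v q)"
  by (simp add: word_sum_def fun_eq_iff)

lemma word_sum_replicate: "word_sum f (replicate n (x, b)) q = int n * (if b then f x q else - f x q)"
  by (simp add: word_sum_def sum_list_replicate)

lemma word_sum_concat: "word_sum f (concat ws) q = (\<Sum>w\<leftarrow>ws. word_sum f w q)"
  by (induction ws) auto

lemma words_append [simp]: "u @ v \<in> words S \<longleftrightarrow> u \<in> words S \<and> v \<in> words S"
  by (simp add: words_def)

lemma words_Nil [simp]: "[] \<in> words S"
  by (simp add: words_def)

lemma words_Cons [simp]: "(x, b) # w \<in> words S \<longleftrightarrow> x \<in> S \<and> w \<in> words S"
  by (auto simp: words_def)

text \<open>In an abelian target only the total exponent of each generator survives. The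
  coefficients are common to all coordinates \<open>q\<close>, so together with the converse below
  this turns surjectivity into a statement about integral spans.\<close>

lemma word_sum_combination:
  assumes "finite S" "w \<in> words S"
  shows "\<exists>n::'x \<Rightarrow> int. \<forall>q. word_sum f w q = (\<Sum>s\<in>S. n s * f s q)"
  using assms(2)
proof (induction w)
  case Nil
  show ?case by (rule exI[of _ "\<lambda>_. 0"]) simp
next
  case (Cons a w)
  obtain x b where a: "a = (x, b)" by force
  with Cons obtain n where n: "\<forall>q. word_sum f w q = (\<Sum>s\<in>S. n s * f s q)" and x: "x \<in> S"
    by auto
  let ?c = "if b then 1 else - 1 :: int"
  have "(\<Sum>s\<in>S. (n s + (if s = x then ?c else 0)) * f s q) =
      (\<Sum>s\<in>S. n s * f s q) + (\<Sum>s\<in>S. if s = x then ?c * f s q else 0)" for q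
    unfolding sum.distrib [symmetric] by (rule sum.cong) (auto simp: algebra_simps)
  then have "word_sum f (a # w) q = (\<Sum>s\<in>S. (n s + (if s = x then ?c else 0)) * f s q)" for q
    using n x assms(1) by (simp add: a)
  then show ?case
    by (intro exI[of _ "\<lambda>s. n s + (if s = x then ?c else 0)"]) blast
qed

lemma combination_word_sum:
  assumes "finite S"
  shows "\<exists>w\<in>words S. \<forall>q. word_sum f w q = (\<Sum>s\<in>S. n s * f s q)"
  using assms
proof (induction S)
  case empty
  show ?case by (rule bexI[of _ "[]"]) auto
next
  case (insert s S)
  then obtain w where w: "w \<in> words S" "\<forall>q. word_sum f w q = (\<Sum>s\<in>S. n s * f s q)" by blast
  \<comment> \<open>The flag \<open>n s \<ge> 0\<close> selects the letter or its inverse, so the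
    block contributes \<open>n s * f s q\<close> for either sign.\<close>
  let ?w = "replicate (nat \<bar>n s\<bar>) (s, n s \<ge> 0) @ w"
  have "?w \<in> words (insert s S)"
    using w(1) by (auto simp: words_def in_lists_conv_set)
  moreover have "\<forall>q. word_sum f ?w q = (\<Sum>s\<in>insert s S. n s * f s q)"
    using insert w(2) by (auto simp: word_sum_replicate)
  ultimately show ?case by blast
qed

lemma word_equiv_words:
  assumes "word_equiv S R u v" "R \<subseteq> words S"
  shows "u \<in> words S \<and> v \<in> words S"
  using assms by induction auto

lemma word_equiv_append_left:
  assumes "word_equiv S R u v" "w \<in> words S"
  shows "word_equiv S R (w @ u) (w @ v)"
  using assms
proof induction
  case (cancel u v x b)
  then show ?case using word_equiv.cancel[of "w @ u" S v x R b] by simp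
next
  case (relator u v r)
  then show ?case using word_equiv.relator[of "w @ u" S v r R] by simp
qed (simp_all add: word_equiv.refl, (metis word_equiv.sym word_equiv.trans)+)

lemma word_equiv_append_right:
  assumes "word_equiv S R u v" "w \<in> words S"
  shows "word_equiv S R (u @ w) (v @ w)"
  using assms
proof induction
  case (cancel u v x b)
  then show ?case using word_equiv.cancel[of u S "v @ w" x R b] by simp
next
  case (relator u v r)
  then show ?case using word_equiv.relator[of u S "v @ w" r R] by simp
qed (simp_all add: word_equiv.refl, (metis word_equiv.sym word_equiv.trans)+)

lemma word_class_eqI: "word_equiv S R u v \<Longrightarrow> word_class S R u = word_class S R v"
  unfolding word_class_def by (rule Collect_cong) (meson word_equiv.sym word_equiv.trans)

lemma word_class_self: "u \<in> words S \<Longrightarrow> u \<in> word_class S R u"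
  by (simp add: word_class_def word_equiv.refl)

text \<open>The product is a union over all pairs of representatives. Since the equivalence is a
  congruence, all classes in this union coincide, and neither index set is empty.\<close>

lemma presented_group_mult:
  assumes "R \<subseteq> words S" "u \<in> words S" "v \<in> words S"
  shows "word_class S R u \<otimes>\<^bsub>presented_group S R\<^esub> word_class S R v = word_class S R (u @ v)"
proof -
  have *: "word_class S R (u' @ v') = word_class S R (u @ v)"
    if "u' \<in> word_class S R u" "v' \<in> word_class S R v" for u' v'
  proof (rule word_class_eqI)
    have *: "word_equiv S R u u'" "word_equiv S R v v'" using that by (auto simp: word_class_def)
    then have "u' \<in> words S" using word_equiv_words assms by blast
    then show "word_equiv S R (u' @ v') (u @ v)"
      using * assms by (meson word_equiv.sym word_equiv.trans word_equiv_append_left word_equiv_append_right)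
  qed
  have "(\<Union>v'\<in>word_class S R v. word_class S R (u' @ v')) = word_class S R (u @ v)"
    if "u' \<in> word_class S R u" for u'
    using * that word_class_self[OF assms(3), of R] by (intro SUP_eq_const) auto
  then have "(\<Union>u'\<in>word_class S R u. \<Union>v'\<in>word_class S R v. word_class S R (u' @ v')) =
      word_class S R (u @ v)"
    using word_class_self[OF assms(2), of R] by - (rule SUP_eq_const, auto simp only: empty_iff)
  then show ?thesis by (simp add: presented_group_def)
qed

lemma carrier_presented_group: "carrier (presented_group S R) = word_class S R ` words S"
  by (simp add: presented_group_def)

section \<open>Coordinates on a finite abelian p-group\<close>

text \<open>
  \<open>E v\<close> is the element of \<open>G\<close> with coordinate \<open>v (i, k)\<close> in the \<open>k\<close>-th cyclic factor of order \<open>p ^ i\<close>;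
  the values of \<open>v\<close> outside the index set are ignored. Lifting elements of \<open>G\<close> to integer vectors
  replaces products over the generators by sums.
\<close>

locale abelian_coordinates = comm_group G for G :: "('g, 'm) monoid_scheme" (structure) +
  fixes p e :: nat and r :: "nat \<Rightarrow> nat" and E :: "(nat \<times> nat \<Rightarrow> int) \<Rightarrow> 'g"
  assumes prime_p: "prime p" and e_pos: "1 \<le> e"
    and E_closed [simp]: "E v \<in> carrier G"
    and E_add: "E (\<lambda>q. v q + w q) = E v \<otimes> E w"
    and E_surj: "g \<in> carrier G \<Longrightarrow> \<exists>v. g = E v"
    and E_eq_one_iff: "E v = \<one> \<longleftrightarrow> (\<forall>i\<in>{1..e}. \<forall>k\<in>{1..r i}. int p ^ i dvd v (i, k))"
begin

lemma E_zero [simp]: "E (\<lambda>q. 0) = \<one>"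
  by (simp add: E_eq_one_iff)

lemma E_uminus: "E (\<lambda>q. - v q) = inv E v"
  using E_add[of "\<lambda>q. - v q" v] by (simp add: inv_equality)

lemma E_pow: "E (\<lambda>q. int n * v q) = E v [^] n"
proof (induction n)
  case (Suc n)
  have "E (\<lambda>q. int n * v q + v q) = E v [^] Suc n"
    by (simp add: E_add Suc)
  then show ?case by (simp add: algebra_simps)
qed simp

lemma E_eq_iff:
  "E v = E w \<longleftrightarrow> (\<forall>i\<in>{1..e}. \<forall>k\<in>{1..r i}. int p ^ i dvd v (i, k) - w (i, k))"
proof -
  have "E (\<lambda>q. v q + - w q) = E v \<otimes> inv E w"
    by (simp only: E_add E_uminus)
  moreover have "E v = E w \<longleftrightarrow> E v \<otimes> inv E w = \<one>"
    using E_closed by (metis inv_closed r_inv inv_equality inv_inv)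
  ultimately show ?thesis
    using E_eq_one_iff[of "\<lambda>q. v q + - w q"] by simp
qed

text \<open>A divisor of \<open>p ^ m\<close> that does not divide \<open>p ^ (m - 1)\<close> is
  \<open>p ^ m\<close> itself, and both divisibilities can be tested coordinatewise. At
  \<open>m = 0\<close> the truncated \<open>m - 1\<close> would make the two conditions contradict
  each other.\<close>

lemma ord_E_iff:
  assumes "1 \<le> m"
  shows "ord (E v) = p ^ m \<longleftrightarrow>
    (\<forall>i\<in>{1..e}. \<forall>k\<in>{1..r i}. int p ^ i dvd int p ^ m * v (i, k)) \<and>
    (\<exists>i\<in>{1..e}. \<exists>k\<in>{1..r i}. \<not> int p ^ i dvd int p ^ (m - 1) * v (i, k))"
proof -
  have dvd: "ord (E v) dvd p ^ n \<longleftrightarrow>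
      (\<forall>i\<in>{1..e}. \<forall>k\<in>{1..r i}. int p ^ i dvd int p ^ n * v (i, k))" for n
    using E_pow[of "p ^ n" v] E_eq_one_iff[of "\<lambda>q. int (p ^ n) * v q"] pow_eq_id[of "E v" "p ^ n"]
    by simp
  have "ord (E v) = p ^ m \<longleftrightarrow> ord (E v) dvd p ^ m \<and> \<not> ord (E v) dvd p ^ (m - 1)"
  proof
    assume "ord (E v) = p ^ m"
    then show "ord (E v) dvd p ^ m \<and> \<not> ord (E v) dvd p ^ (m - 1)"
      using assms prime_gt_1_nat[OF prime_p] by (auto dest!: power_dvd_imp_le)
  next
    assume *: "ord (E v) dvd p ^ m \<and> \<not> ord (E v) dvd p ^ (m - 1)"
    then obtain n where n: "n \<le> m" "ord (E v) = p ^ n"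
      using divides_primepow_nat[OF prime_p] by blast
    with * have "\<not> n \<le> m - 1" by (auto simp: le_imp_power_dvd)
    with n show "ord (E v) = p ^ m" by (metis assms le_neq_implies_less le_add_diff_inverse less_Suc_eq_le plus_1_eq_Suc)
  qed
  then show ?thesis unfolding dvd by auto
qed

end

section \<open>Smooth epimorphisms as integer vectors attached to the generators\<close>

lemma finite_Gamma_generators [simp]: "finite (Gamma_generators e d)"
proof -
  have "{GenC i j | i j. i \<in> {1..e} \<and> j \<in> {1..x i}} = (\<lambda>(i, j). GenC i j) ` (SIGMA i:{1..e}. {1..x i})"
    for x :: "nat \<Rightarrow> nat"
    by force
  then show ?thesis by (cases d) (simp add: Gamma_generators_def)
qed

text \<open>Each commutator contributes zero, so the handle generators drop out of the product
  relation.\<close>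

lemma word_sum_long_relator:
  "word_sum f (long_relator e d) q = (\<Sum>i=1..e. \<Sum>j=1..fst d i. f (GenC i j) q)"
proof -
  obtain x h where d: "d = (x, h)" by force
  have "word_sum f (map (\<lambda>j. (GenC i j, True)) [1..<Suc (x i)]) q = (\<Sum>j=1..x i. f (GenC i j) q)" for i
    by (simp only: word_sum_def map_map o_def prod.case if_True interv_sum_list_conv_sum_set_nat set_upt
        atLeastLessThanSuc_atLeastAtMost)
  then show ?thesis
    unfolding d long_relator_def prod.case word_sum_append word_sum_concat map_map o_def fst_conv
    by (simp only: interv_sum_list_conv_sum_set_nat set_upt atLeastLessThanSuc_atLeastAtMost)
       (simp add: word_sum_def)
qed

lemma Gamma_relators_words: "Gamma_relators p e d \<subseteq> words (Gamma_generators e d)"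
proof -
  obtain x h where d: "d = (x, h)" by force
  show ?thesis
    by (auto simp: Gamma_relators_def Gamma_generators_def long_relator_def d words_def
        in_lists_conv_set)
qed

context abelian_coordinates
begin

text \<open>\<open>f\<close> lifts the images of the generators to integer vectors. The clauses are
  smoothness, the long relator and surjectivity; the power relators follow from the orders in the
  first clause.\<close>

definition realizes :: "p_datum \<Rightarrow> (generator \<Rightarrow> nat \<times> nat \<Rightarrow> int) \<Rightarrow> bool" where
  "realizes d f \<longleftrightarrow>
     (\<forall>i\<in>{1..e}. \<forall>j\<in>{1..fst d i}. ord (E (f (GenC i j))) = p ^ i) \<and>
     E (\<lambda>q. \<Sum>i=1..e. \<Sum>j=1..fst d i. f (GenC i j) q) = \<one> \<and>
     (\<forall>v. \<exists>n. E v = E (\<lambda>q. \<Sum>s\<in>Gamma_generators e d. n s * f s q))"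

lemma smooth_epi_realizes:
  assumes "smooth_epi p e d G \<phi>"
  shows "\<exists>f. realizes d f"
proof -
  define S R where "S = Gamma_generators e d" and "R = Gamma_relators p e d"
  have R: "R \<subseteq> words S" using Gamma_relators_words by (simp add: R_def S_def)
  have \<phi>: "\<phi> \<in> hom (presented_group S R) G" "\<phi> ` (word_class S R ` words S) = carrier G"
    using assms by (auto simp: smooth_epi_def epi_def Gamma_group_def S_def R_def carrier_presented_group)
  have \<phi>_closed: "\<phi> (word_class S R w) \<in> carrier G" if "w \<in> words S" for w
    using \<phi>(2) that by blast
  have \<phi>_mult: "\<phi> (word_class S R (u @ v)) = \<phi> (word_class S R u) \<otimes> \<phi> (word_class S R v)"
    if "u \<in> words S" "v \<in> words S" for u v
    using hom_mult[OF \<phi>(1), of "word_class S R u" "word_class S R v"] that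
    by (simp add: presented_group_mult[OF R] carrier_presented_group)
  have \<phi>_Nil: "\<phi> (word_class S R []) = \<one>"
    using \<phi>_mult[of "[]" "[]"] \<phi>_closed[of "[]"] by simp
  \<comment> \<open>Any lift will do: \<open>E\<close> forgets the choice, and the values on single
    letters determine \<phi> on all words.\<close>
  define f where "f x = (SOME v. \<phi> (word_class S R [(x, True)]) = E v)" for x
  have f: "\<phi> (word_class S R [(x, True)]) = E (f x)" if "x \<in> S" for x
  proof -
    have "\<exists>v. \<phi> (word_class S R [(x, True)]) = E v"
      using E_surj[OF \<phi>_closed[of "[(x, True)]"]] that by simp
    then show ?thesis unfolding f_def by (rule someI_ex)
  qed
  have f': "\<phi> (word_class S R [(x, False)]) = inv E (f x)" if "x \<in> S" for x
  proof -
    have "word_class S R ([(x, False)] @ [(x, True)]) = word_class S R []"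
      using word_equiv.cancel[of "[]" S "[]" x R False] that by (intro word_class_eqI) simp
    then have "\<phi> (word_class S R [(x, False)]) \<otimes> E (f x) = \<one>"
      using that f by (metis \<phi>_Nil \<phi>_mult words_Cons words_Nil)
    then show ?thesis using that by (metis E_closed inv_equality \<phi>_closed words_Cons words_Nil)
  qed
  have ev: "\<phi> (word_class S R w) = E (word_sum f w)" if "w \<in> words S" for w
    using that
  proof (induction w)
    case (Cons a w)
    obtain x b where a: "a = (x, b)" by force
    have "\<phi> (word_class S R (a # w)) = \<phi> (word_class S R [a]) \<otimes> E (word_sum f w)"
      using \<phi>_mult[of "[a]" w] Cons by (simp add: a)
    also have "\<phi> (word_class S R [a]) = E (\<lambda>q. if b then f x q else - f x q)"
      using f[of x] f'[of x] Cons.prems by (cases b) (simp_all add: a E_uminus)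
    finally show ?case by (simp add: a E_add)
  qed (simp add: \<phi>_Nil)
  have "realizes d f"
    unfolding realizes_def
  proof (intro conjI allI ballI)
    fix i j assume ij: "i \<in> {1..e}" "j \<in> {1..fst d i}"
    then have "GenC i j \<in> S" by (cases d) (auto simp: S_def Gamma_generators_def)
    with f[OF this] show "ord (E (f (GenC i j))) = p ^ i"
      using ij assms unfolding smooth_epi_def Gamma_c_def S_def R_def by metis
  next
    have "long_relator e d \<in> R" by (simp add: R_def Gamma_relators_def)
    then have "word_class S R (long_relator e d) = word_class S R []"
      using word_equiv.relator[of "[]" S "[]" "long_relator e d" R] by (intro word_class_eqI) simp
    then have "E (word_sum f (long_relator e d)) = \<one>"
      using ev[of "long_relator e d"] \<open>long_relator e d \<in> R\<close> R \<phi>_Nil by auto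
    then show "E (\<lambda>q. \<Sum>i=1..e. \<Sum>j=1..fst d i. f (GenC i j) q) = \<one>"
      by (simp add: word_sum_long_relator[abs_def])
  next
    fix v
    obtain w where w: "w \<in> words S" "E v = E (word_sum f w)"
      using \<phi>(2) ev E_closed[of v] by (smt (verit) image_iff)
    then obtain n where "\<forall>q. word_sum f w q = (\<Sum>s\<in>S. n s * f s q)"
      using word_sum_combination[of S w f] by (auto simp: S_def)
    then have "word_sum f w = (\<lambda>q. \<Sum>s\<in>S. n s * f s q)" by auto
    with w show "\<exists>n. E v = E (\<lambda>q. \<Sum>s\<in>Gamma_generators e d. n s * f s q)"
      unfolding S_def by auto
  qed
  then show ?thesis by blast
qed

text \<open>Von Dyck's argument: evaluating a word by \<open>word_sum f\<close> and then
  \<open>E\<close> is multiplicative and sends every relator to the identity, hence it is constant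
  on word classes and descends to the presented group.\<close>

lemma realizes_smooth_epi:
  assumes "realizes d f"
  shows "\<exists>\<phi>. smooth_epi p e d G \<phi>"
proof -
  define S R where "S = Gamma_generators e d" and "R = Gamma_relators p e d"
  have R: "R \<subseteq> words S" using Gamma_relators_words by (simp add: R_def S_def)
  have rel: "E (word_sum f u) = \<one>" if "u \<in> R" for u
  proof -
    have "u = long_relator e d \<or> (\<exists>i j. i \<in> {1..e} \<and> j \<in> {1..fst d i} \<and>
        u = replicate (p ^ i) (GenC i j, True))"
      using that unfolding R_def Gamma_relators_def by blast
    then consider "u = long_relator e d"
      | i j where "i \<in> {1..e}" "j \<in> {1..fst d i}" "u = replicate (p ^ i) (GenC i j, True)"
      by blast
    then show ?thesis
    proof cases
      case 1
      then show ?thesis using assms by (simp add: realizes_def word_sum_long_relator[abs_def])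
    next
      case 2
      then have "ord (E (f (GenC i j))) = p ^ i" using assms by (auto simp: realizes_def)
      then have "E (f (GenC i j)) [^] (p ^ i) = \<one>" by (metis E_closed pow_ord_eq_1)
      moreover have "word_sum f u = (\<lambda>q. int (p ^ i) * f (GenC i j) q)"
        by (simp add: 2 word_sum_replicate fun_eq_iff)
      ultimately show ?thesis by (simp only: E_pow)
    qed
  qed
  have inv: "E (word_sum f u) = E (word_sum f v)" if "word_equiv S R u v" for u v
    using that
  proof induction
    case (relator u v r)
    then show ?case by (simp add: E_add rel)
  next
    case (cancel u v x b)
    have "word_sum f (u @ [(x, b), (x, \<not> b)] @ v) = word_sum f (u @ v)"
      by (auto simp: fun_eq_iff)
    then show ?case by simp
  qed auto
  define \<phi> where "\<phi> A = E (word_sum f (SOME w. w \<in> A))" for A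
  have \<phi>: "\<phi> (word_class S R w) = E (word_sum f w)" if "w \<in> words S" for w
  proof -
    have "(SOME u. u \<in> word_class S R w) \<in> word_class S R w"
      using word_class_self[OF that] by (rule someI)
    then show ?thesis using inv by (auto simp: \<phi>_def word_class_def)
  qed
  have hom: "\<phi> \<in> hom (presented_group S R) G"
  proof (rule homI)
    fix A assume "A \<in> carrier (presented_group S R)"
    then show "\<phi> A \<in> carrier G" by (auto simp: \<phi>_def)
  next
    fix A B assume "A \<in> carrier (presented_group S R)" "B \<in> carrier (presented_group S R)"
    then obtain u v where "u \<in> words S" "v \<in> words S" "A = word_class S R u" "B = word_class S R v"
      by (auto simp: carrier_presented_group)
    then show "\<phi> (A \<otimes>\<^bsub>presented_group S R\<^esub> B) = \<phi> A \<otimes> \<phi> B"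
      by (simp add: presented_group_mult[OF R] \<phi> E_add)
  qed
  have onto: "\<phi> ` carrier (presented_group S R) = carrier G"
  proof
    show "\<phi> ` carrier (presented_group S R) \<subseteq> carrier G" by (auto simp: \<phi>_def)
    show "carrier G \<subseteq> \<phi> ` carrier (presented_group S R)"
    proof
      fix g assume "g \<in> carrier G"
      then obtain v where v: "g = E v" using E_surj by blast
      then obtain n where n: "g = E (\<lambda>q. \<Sum>s\<in>S. n s * f s q)"
        using assms unfolding realizes_def S_def by blast
      obtain w where w: "w \<in> words S" "\<forall>q. word_sum f w q = (\<Sum>s\<in>S. n s * f s q)"
        using combination_word_sum[of S f n] by (auto simp: S_def)
      then have "word_sum f w = (\<lambda>q. \<Sum>s\<in>S. n s * f s q)" by auto
      with n \<phi>[OF w(1)] have "g = \<phi> (word_class S R w)" by simp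
      with w(1) show "g \<in> \<phi> ` carrier (presented_group S R)" by (auto simp: carrier_presented_group)
    qed
  qed
  have "ord (\<phi> (Gamma_c p e d i j)) = p ^ i" if "i \<in> {1..e}" "j \<in> {1..fst d i}" for i j
  proof -
    have "[(GenC i j, True)] \<in> words S"
      using that by (cases d) (auto simp: S_def Gamma_generators_def)
    from \<phi>[OF this] have "\<phi> (Gamma_c p e d i j) = E (f (GenC i j))"
      by (simp add: Gamma_c_def S_def R_def)
    then show ?thesis using assms that by (auto simp: realizes_def)
  qed
  then have "smooth_epi p e d G \<phi>"
    using hom onto by (auto simp: smooth_epi_def epi_def Gamma_group_def S_def R_def)
  then show ?thesis by blast
qed

lemma data_spectrum_iff:
  "d \<in> data_spectrum p e G \<longleftrightarrow> (\<forall>i. i \<notin> {1..e} \<longrightarrow> fst d i = 0) \<and> (\<exists>f. realizes d f)"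
  unfolding data_spectrum_def mem_Collect_eq by (meson smooth_epi_realizes realizes_smooth_epi)

end

lemma abelian_coordinates_exist:
  fixes G :: "('g, 'm) monoid_scheme" (structure)
  assumes "prime p" "1 \<le> e" "comm_group G"
    and iso: "G \<cong> sum_group (SIGMA i:{1..e}. {1..r i}) (\<lambda>(i, k). integer_mod_group (p ^ i))"
  shows "\<exists>E. abelian_coordinates G p e r E"
proof -
  interpret comm_group G by fact
  define I where "I = (SIGMA i:{1..e}. {1..r i})"
  define H where "H = sum_group I (\<lambda>(i, k). integer_mod_group (p ^ i))"
  \<comment> \<open>Restricting to \<open>I\<close> makes \<open>c v\<close> extensional, as the
    elements of the sum group are. Hence \<open>c v\<close> depends only on the residues of
    \<open>v\<close> on \<open>I\<close>.\<close>
  define c where "c v = (\<lambda>q\<in>I. v q mod int p ^ fst q)" for v :: "nat \<times> nat \<Rightarrow> int"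
  have p: "p > 0" using assms(1) by (simp add: prime_gt_0_nat)
  obtain \<eta> where \<eta>: "\<eta> \<in> hom H G" "bij_betw \<eta> (carrier H) (carrier G)"
    using iso_sym[OF iso] by (auto simp: is_iso_def iso_def H_def I_def)
  have carrier_H: "carrier H = (\<Pi>\<^sub>E q\<in>I. {0..<int p ^ fst q})"
  proof -
    \<comment> \<open>The sum group consists of families of finite support, which is automatic over
      the finite index set \<open>I\<close>.\<close>
    have fin: "finite {q \<in> I. P q}" for P
      by (rule finite_subset[of _ I]) (auto simp: I_def)
    have "carrier (integer_mod_group (p ^ fst q)) = {0..<int p ^ fst q}" for q :: "nat \<times> nat"
      using p by (simp add: carrier_integer_mod_group)
    then show ?thesis
      unfolding H_def by (subst carrier_sum_group) (simp_all add: fin case_prod_beta')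
  qed
  have c_closed: "c v \<in> carrier H" for v
    using p by (auto simp: carrier_H c_def)
  have c_add: "c (\<lambda>q. v q + w q) = c v \<otimes>\<^bsub>H\<^esub> c w" for v w
    by (auto simp: H_def c_def I_def mod_add_eq)
  have c_zero: "c (\<lambda>q. 0) = \<one>\<^bsub>H\<^esub>"
    by (auto simp: H_def c_def I_def)
  have grp: "group H" unfolding H_def by (rule sum_group) (auto split: prod.splits)
  define E where "E v = \<eta> (c v)" for v
  have "E v = \<one> \<longleftrightarrow> (\<forall>i\<in>{1..e}. \<forall>k\<in>{1..r i}. int p ^ i dvd v (i, k))" for v
  proof -
    have "\<eta> \<one>\<^bsub>H\<^esub> = \<one>" using \<eta>(1) grp is_group by (rule hom_one)
    then have "E v = \<one> \<longleftrightarrow> \<eta> (c v) = \<eta> (c (\<lambda>q. 0))"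
      unfolding E_def c_zero by simp
    also have "\<dots> \<longleftrightarrow> c v = c (\<lambda>q. 0)"
      using inj_on_eq_iff[OF bij_betw_imp_inj_on[OF \<eta>(2)]] c_closed by blast
    also have "\<dots> \<longleftrightarrow> (\<forall>q\<in>I. int p ^ fst q dvd v q)"
      unfolding c_def fun_eq_iff restrict_def by (auto simp: mod_eq_0_iff_dvd)
    finally show ?thesis unfolding I_def by simp
  qed
  moreover have "\<exists>v. g = E v" if g: "g \<in> carrier G" for g
  proof -
    have "g \<in> \<eta> ` carrier H" unfolding bij_betw_imp_surj_on[OF \<eta>(2)] by (rule g)
    then obtain v where v: "v \<in> carrier H" "g = \<eta> v" by (elim imageE)
    then have "v q = c v q" for q
      by (cases q; cases "q \<in> I") (auto simp: c_def carrier_H PiE_iff extensional_def)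
    then have "c v = v" by auto
    with v have "g = E v" by (simp add: E_def)
    then show ?thesis by (rule exI[of _ v])
  qed
  moreover have "E v \<in> carrier G" for v
    unfolding E_def using bij_betwE[OF \<eta>(2)] c_closed by blast
  moreover have "E (\<lambda>q. v q + w q) = E v \<otimes> E w" for v w
    by (simp add: E_def c_add hom_mult[OF \<eta>(1)] c_closed)
  ultimately have "abelian_coordinates G p e r E"
    using assms(1,2) by unfold_locales
  then show ?thesis by (rule exI[of _ E])
qed

section \<open>The rank bound\<close>

text \<open>Counting takes the place of dimension theory. Reducing coefficients modulo
  \<open>p\<close> does not change the residues of a combination, so the \<open>p ^ card T\<close>
  reduced coefficient vectors map onto all \<open>p ^ card J\<close> residue vectors on
  \<open>J\<close>.\<close>

lemma card_le_of_span_mod: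
  fixes f :: "'s \<Rightarrow> 'q \<Rightarrow> int" and p :: nat
  assumes p: "2 \<le> p" and fin: "finite T" "finite J"
    and span: "\<And>v. \<exists>n. \<forall>q\<in>J. int p dvd v q - (\<Sum>s\<in>T. n s * f s q)"
  shows "card J \<le> card T"
proof -
  define F where "F n = (\<lambda>q\<in>J. (\<Sum>s\<in>T. n s * f s q) mod int p)" for n
  have "(J \<rightarrow>\<^sub>E {0..<int p}) \<subseteq> F ` (T \<rightarrow>\<^sub>E {0..<int p})"
  proof
    fix v assume v: "v \<in> J \<rightarrow>\<^sub>E {0..<int p}"
    obtain n where n: "\<forall>q\<in>J. int p dvd v q - (\<Sum>s\<in>T. n s * f s q)" using span by blast
    define n' where "n' = (\<lambda>s\<in>T. n s mod int p)"
    have "F n' q = v q" if q: "q \<in> J" for q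
    proof -
      have "(\<Sum>s\<in>T. n' s * f s q) mod int p = (\<Sum>s\<in>T. (n' s * f s q) mod int p) mod int p"
        by (rule mod_sum_eq [symmetric])
      also have "\<dots> = (\<Sum>s\<in>T. (n s * f s q) mod int p) mod int p"
        by (simp add: n'_def mod_mult_left_eq)
      also have "\<dots> = (\<Sum>s\<in>T. n s * f s q) mod int p" by (rule mod_sum_eq)
      also have "\<dots> = v q mod int p" using n q by (metis mod_eq_dvd_iff)
      also have "\<dots> = v q" using v q by (auto simp: PiE_iff)
      finally show ?thesis using q by (simp add: F_def)
    qed
    then have "v = F n'"
      by (intro extensionalityI[of _ J]) (use v in \<open>auto simp: F_def PiE_iff\<close>)
    moreover have "n' \<in> T \<rightarrow>\<^sub>E {0..<int p}" using p by (auto simp: n'_def)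
    ultimately show "v \<in> F ` (T \<rightarrow>\<^sub>E {0..<int p})" by blast
  qed
  then have "card (J \<rightarrow>\<^sub>E {0..<int p}) \<le> card (F ` (T \<rightarrow>\<^sub>E {0..<int p}))"
    using fin by (intro card_mono finite_imageI finite_PiE) auto
  also have "\<dots> \<le> card (T \<rightarrow>\<^sub>E {0..<int p})"
    using fin by (intro card_image_le finite_PiE) auto
  finally have "p ^ card J \<le> p ^ card T" using fin by (simp add: card_PiE)
  then show ?thesis using p by (simp add: power_increasing_iff)
qed

lemma Gamma_generators_c_iff:
  "GenC i k \<in> Gamma_generators e d \<longleftrightarrow> i \<in> {1..e} \<and> k \<in> {1..fst d i}"
  by (cases d) (auto simp: Gamma_generators_def)

lemma Gamma_generators_eq:
  "Gamma_generators e (x, h) =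
     GenA ` {1..h} \<union> GenB ` {1..h} \<union> (\<lambda>(i, k). GenC i k) ` (SIGMA i:{1..e}. {1..x i})"
  by (force simp: Gamma_generators_def)

context abelian_coordinates
begin

text \<open>The conditional 1 is the generator saved by the product relation: modulo
  \<open>p\<close>, on the coordinates in \<open>J\<close>, the remaining c add up to zero, so any
  one of them is a combination of the others.\<close>

lemma rank_bound:
  assumes f: "realizes (x, h) f" and m: "m < e"
  shows "(\<Sum>i=m+1..e. r i) + (if (\<Sum>i=m+1..e. x i) > 0 then 1 else 0) \<le> 2 * h + (\<Sum>i=m+1..e. x i)"
proof -
  define C where "C = (SIGMA i:{m+1..e}. {1..x i})"
  define D where "D = (SIGMA i:{1..m}. {1..x i})"
  define J where "J = (SIGMA i:{m+1..e}. {1..r i})"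
  define c where "c = (\<lambda>(i, k). GenC i k)"
  define AB where "AB = GenA ` {1..h} \<union> GenB ` {1..h}"
  have c_inj: "inj_on c X" for X by (auto simp: c_def inj_on_def)
  have fin: "finite C" "finite D" "finite J" "finite AB"
    by (auto simp: C_def D_def J_def AB_def)
  have CD: "(SIGMA i:{1..e}. {1..x i}) = C \<union> D"
    using m by (auto simp: C_def D_def)
  have gens: "Gamma_generators e (x, h) = AB \<union> c ` C \<union> c ` D"
    unfolding Gamma_generators_eq CD AB_def c_def by (simp add: image_Un Un_assoc)
  have disj: "AB \<inter> c ` C = {}" "AB \<inter> c ` D = {}" "c ` C \<inter> c ` D = {}"
    by (auto simp: AB_def c_def C_def D_def)
  have card_C: "card C = (\<Sum>i=m+1..e. x i)" and card_J: "card J = (\<Sum>i=m+1..e. r i)"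
    by (simp_all add: C_def J_def)
  have card_AB: "card AB = 2 * h"
    unfolding AB_def by (subst card_Un_disjoint) (auto simp: card_image inj_on_def)
  have p_dvd: "int p dvd v q"
    if v: "\<forall>i\<in>{1..e}. \<forall>k\<in>{1..r i}. int p ^ i dvd v (i, k)" and q: "q \<in> J" for v q
  proof -
    obtain i k where "q = (i, k)" "i \<in> {1..e}" "k \<in> {1..r i}" using q by (auto simp: J_def)
    then have "int p ^ i dvd v q" "int p dvd int p ^ i" using v by (auto intro: dvd_power)
    then show ?thesis by (metis dvd_trans)
  qed
  \<comment> \<open>An element of order \<open>p ^ i\<close> has coordinates divisible by
    \<open>p ^ (i' - i)\<close> in a factor of order \<open>p ^ i'\<close>, and here
    \<open>i \<le> m < i'\<close>.\<close>
  have D_dvd: "int p dvd f (c a) q" if a: "a \<in> D" and q: "q \<in> J" for a q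
  proof -
    obtain i k where ik: "a = (i, k)" "1 \<le> i" "i \<le> m" "k \<in> {1..x i}" using a by (auto simp: D_def)
    obtain i' k' where q': "q = (i', k')" "m < i'" "i' \<le> e" "k' \<in> {1..r i'}"
      using q by (auto simp: J_def)
    have "i \<in> {1..e}" using ik m by auto
    then have "ord (E (f (GenC i k))) = p ^ i" using f ik by (auto simp: realizes_def)
    then have "int p ^ i' dvd int p ^ i * f (GenC i k) q"
      using ord_E_iff[of i "f (GenC i k)"] ik q' by auto
    moreover have "int p ^ i' = int p ^ i * int p ^ (i' - i)"
      using ik q' by (simp flip: power_add)
    ultimately have "int p ^ (i' - i) dvd f (GenC i k) q"
      using prime_gt_0_nat[OF prime_p] by simp
    moreover have "int p dvd int p ^ (i' - i)" using ik q' by (intro dvd_power) auto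
    ultimately show ?thesis using ik by (auto simp: c_def intro: dvd_trans)
  qed
  have span: "\<exists>n. \<forall>q\<in>J. int p dvd v q - (\<Sum>s\<in>AB \<union> c ` C. n s * f s q)" for v
  proof -
    obtain n where "E v = E (\<lambda>q. \<Sum>s\<in>Gamma_generators e (x, h). n s * f s q)"
      using f unfolding realizes_def by blast
    then have n: "int p dvd v q - (\<Sum>s\<in>Gamma_generators e (x, h). n s * f s q)" if "q \<in> J" for q
      using p_dvd[OF _ that, of "\<lambda>q. v q - (\<Sum>s\<in>Gamma_generators e (x, h). n s * f s q)"]
      unfolding E_eq_iff by blast
    have "int p dvd v q - (\<Sum>s\<in>AB \<union> c ` C. n s * f s q)" if q: "q \<in> J" for q
    proof -
      have "(\<Sum>s\<in>Gamma_generators e (x, h). n s * f s q) =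
          (\<Sum>s\<in>AB \<union> c ` C. n s * f s q) + (\<Sum>s\<in>c ` D. n s * f s q)"
        unfolding gens using fin disj by (intro sum.union_disjoint) auto
      moreover have "int p dvd (\<Sum>s\<in>c ` D. n s * f s q)"
        by (intro dvd_sum dvd_mult) (use D_dvd[OF _ q] in blast)
      ultimately show ?thesis using dvd_add[OF n[OF q], of "\<Sum>s\<in>c ` D. n s * f s q"] by simp
    qed
    then show ?thesis by blast
  qed
  have rel: "int p dvd (\<Sum>a\<in>C. f (c a) q)" if q: "q \<in> J" for q
  proof -
    have "E (\<lambda>q. \<Sum>i=1..e. \<Sum>k=1..x i. f (GenC i k) q) = \<one>"
      using f by (auto simp: realizes_def)
    then have "int p dvd (\<Sum>i=1..e. \<Sum>k=1..x i. f (GenC i k) q)"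
      using p_dvd[OF _ q, of "\<lambda>q. \<Sum>i=1..e. \<Sum>k=1..x i. f (GenC i k) q"]
      unfolding E_eq_one_iff by blast
    also have "(\<Sum>i=1..e. \<Sum>k=1..x i. f (GenC i k) q) = (\<Sum>a\<in>C \<union> D. f (c a) q)"
    proof -
      show ?thesis by (simp add: sum.Sigma CD [simplified] c_def case_prod_beta')
    qed
    also have "\<dots> = (\<Sum>a\<in>C. f (c a) q) + (\<Sum>a\<in>D. f (c a) q)"
      using fin by (intro sum.union_disjoint) (auto simp: C_def D_def)
    finally have "int p dvd (\<Sum>a\<in>C. f (c a) q) + (\<Sum>a\<in>D. f (c a) q)" .
    moreover have "int p dvd (\<Sum>a\<in>D. f (c a) q)" by (intro dvd_sum D_dvd q)
    ultimately show ?thesis by (simp add: dvd_add_left_iff)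
  qed
  show ?thesis
  proof (cases "C = {}")
    case True
    then have "card J \<le> card AB"
      using card_le_of_span_mod[of p AB J f] span prime_ge_2_nat[OF prime_p] fin by simp
    then show ?thesis using True card_C card_J card_AB by simp
  next
    case False
    then obtain c0 where c0: "c0 \<in> C" by blast
    define T where "T = AB \<union> c ` (C - {c0})"
    have T: "AB \<union> c ` C = insert (c c0) T" "c c0 \<notin> T" "finite T"
      using c0 fin disj by (auto simp: T_def inj_on_image_set_diff[OF c_inj[of UNIV]] dest: inj_onD[OF c_inj[of UNIV]])
    have "\<exists>n. \<forall>q\<in>J. int p dvd v q - (\<Sum>s\<in>T. n s * f s q)" for v
    proof -
      obtain n where n: "\<forall>q\<in>J. int p dvd v q - (\<Sum>s\<in>AB \<union> c ` C. n s * f s q)"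
        using span by blast
      \<comment> \<open>Subtracting \<open>n (c c0)\<close> times the product relation makes the
        coefficient of \<open>c c0\<close> zero without changing the combination modulo
        \<open>p\<close>.\<close>
      define n' where "n' s = n s - (if s \<in> c ` C then n (c c0) else 0)" for s
      have "int p dvd v q - (\<Sum>s\<in>T. n' s * f s q)" if q: "q \<in> J" for q
      proof -
        have 1: "(\<Sum>s\<in>AB \<union> c ` C. n' s * f s q) = (\<Sum>s\<in>T. n' s * f s q)"
          unfolding T(1) using T(2,3) c0 by (simp add: n'_def)
        have "(\<Sum>s\<in>AB \<union> c ` C. n' s * f s q) =
            (\<Sum>s\<in>AB \<union> c ` C. n s * f s q) - (\<Sum>s\<in>AB \<union> c ` C. (if s \<in> c ` C then n (c c0) * f s q else 0))"
          unfolding sum_subtractf [symmetric] by (rule sum.cong) (auto simp: n'_def algebra_simps)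
        also have "(\<Sum>s\<in>AB \<union> c ` C. (if s \<in> c ` C then n (c c0) * f s q else 0)) =
            (\<Sum>s\<in>c ` C. n (c c0) * f s q)"
          using fin by (subst sum.inter_restrict [symmetric]) (auto intro: sum.cong)
        also have "\<dots> = n (c c0) * (\<Sum>a\<in>C. f (c a) q)"
          by (simp add: sum.reindex[OF c_inj] sum_distrib_left)
        finally have eq: "v q - (\<Sum>s\<in>T. n' s * f s q) =
            (v q - (\<Sum>s\<in>AB \<union> c ` C. n s * f s q)) + n (c c0) * (\<Sum>a\<in>C. f (c a) q)"
          using 1 by simp
        show ?thesis unfolding eq by (intro dvd_add dvd_mult rel q bspec[OF n])
      qed
      then show ?thesis by blast
    qed
    then have "card J \<le> card T"
      using card_le_of_span_mod[of p T J f] prime_ge_2_nat[OF prime_p] fin T by simp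
    moreover have "card T = card AB + card (C - {c0})"
      unfolding T_def using fin disj by (subst card_Un_disjoint) (auto simp: card_image[OF c_inj])
    moreover have "card C > 0" using c0 fin by (auto simp: card_gt_0_iff)
    ultimately show ?thesis using card_C card_J card_AB c0 fin by (simp add: card_Diff_singleton)
  qed
qed

end

section \<open>Twice the excess of a reduced genus over the minimum\<close>

text \<open>The doubling keeps the value integral. The constant \<open>1 - p ^ e\<close> is
  \<open>- 2 * p ^ e\<close> from the genus formula plus \<open>1 + p ^ e\<close> from the
  minimum.\<close>

definition gap :: "nat \<Rightarrow> nat \<Rightarrow> (nat \<Rightarrow> nat) \<Rightarrow> p_datum \<Rightarrow> int" where
  "gap p e r = (\<lambda>(x, h). 2 * int h * int p ^ e - int p ^ e + 1 +
     (\<Sum>i=1..e. (int (x i) - int (r i)) * (int p ^ e - int p ^ (e - i))))"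

lemma reduced_genus_eq_gap:
  "reduced_genus p e d =
     1 / 2 * (- 1 - of_nat p ^ e + (\<Sum>i=1..e. (of_nat p ^ e - of_nat p ^ (e - i)) * of_nat (r i)))
     + of_int (gap p e r d) / 2"
proof -
  obtain x h where d: "d = (x, h)" by force
  have "(\<Sum>i=1..e. (of_nat (x i) - of_nat (r i)) * (of_nat p ^ e - of_nat p ^ (e - i))) =
      (\<Sum>i=1..e. of_nat (x i) * (of_nat p ^ e - of_nat p ^ (e - i))) -
      (\<Sum>i=1..e. (of_nat p ^ e - of_nat p ^ (e - i)) * (of_nat (r i) :: rat))"
    by (simp add: algebra_simps flip: sum_subtractf)
  then show ?thesis by (simp add: d gap_def reduced_genus_def field_simps)
qed

text \<open>Telescoping: for \<open>i \<le> e\<close> the summand is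
  \<open>p ^ (e - i + 1) - p ^ (e - i)\<close>.\<close>

lemma sum_geometric_weights:
  fixes p :: int
  assumes "m \<le> e"
  shows "(\<Sum>i=m+1..e. p ^ (e - i) * (p - 1)) = p ^ (e - m) - 1"
  using assms
proof (induction rule: inc_induct)
  case (step m)
  have "p ^ (e - m) = p * p ^ (e - Suc m)" using step by (metis Suc_diff_Suc power_Suc)
  moreover have "(\<Sum>i=m+1..e. p ^ (e - i) * (p - 1)) =
      p ^ (e - Suc m) * (p - 1) + (\<Sum>i=Suc m+1..e. p ^ (e - i) * (p - 1))"
    using step by (simp add: sum.atLeast_Suc_atMost)
  ultimately show ?case using step by (simp add: algebra_simps)
qed simp

text \<open>Exchanging the summations, \<open>a l\<close> collects the weights with index from
  \<open>m + 1\<close> to \<open>l\<close>, and these telescope to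
  \<open>p ^ (e - m) - p ^ (e - l)\<close>.\<close>

lemma sum_tail_sums_weights:
  fixes p :: int
  assumes "m \<le> e"
  shows "(\<Sum>i=m+1..e. (\<Sum>l=i..e. a l) * (p ^ (e - i) * (p - 1))) =
    (\<Sum>l=m+1..e. a l * (p ^ (e - m) - p ^ (e - l)))"
  using assms
proof (induction rule: inc_induct)
  case (step m)
  let ?P = "p ^ (e - Suc m)"
  have P: "p ^ (e - m) = p * ?P" using step by (metis Suc_diff_Suc power_Suc)
  have "(\<Sum>i=m+1..e. (\<Sum>l=i..e. a l) * (p ^ (e - i) * (p - 1))) =
      (\<Sum>l=m+1..e. a l) * (?P * (p - 1)) + (\<Sum>i=Suc m+1..e. (\<Sum>l=i..e. a l) * (p ^ (e - i) * (p - 1)))"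
    using step by (simp add: sum.atLeast_Suc_atMost)
  also have "(\<Sum>i=Suc m+1..e. (\<Sum>l=i..e. a l) * (p ^ (e - i) * (p - 1))) =
      (\<Sum>l=m+1..e. a l * (?P - p ^ (e - l)))"
    using step by (simp add: sum.atLeast_Suc_atMost[of "Suc m"])
  also have "(\<Sum>l=m+1..e. a l) * (?P * (p - 1)) + (\<Sum>l=m+1..e. a l * (?P - p ^ (e - l))) =
      (\<Sum>l=m+1..e. a l * (p ^ (e - m) - p ^ (e - l)))"
    unfolding sum_distrib_right sum.distrib [symmetric] P
    by (rule sum.cong) (auto simp: algebra_simps)
  finally show ?case .
qed simp

text \<open>The first factor of each summand is the slack in the strict rank bound for the tail
  starting at \<open>i\<close>. The lone \<open>2 * int h\<close> appears because the weights add up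
  to \<open>p ^ e - 1\<close> and not to \<open>p ^ e\<close>. This is the form in which a gap can
  be prescribed by digits.\<close>

lemma gap_eq:
  "gap p e r (x, h) = 2 * int h +
     (\<Sum>i=1..e. ((\<Sum>l=i..e. int (x l)) + 2 * int h - (\<Sum>l=i..e. int (r l)) - 1) *
       (int p ^ (e - i) * (int p - 1)))"
proof -
  let ?w = "\<lambda>i. int p ^ (e - i) * (int p - 1)"
  have "(\<Sum>i=1..e. ((\<Sum>l=i..e. int (x l)) + 2 * int h - (\<Sum>l=i..e. int (r l)) - 1) * ?w i) =
      (\<Sum>i=1..e. (\<Sum>l=i..e. int (x l) - int (r l)) * ?w i) + (2 * int h - 1) * (\<Sum>i=1..e. ?w i)"
    unfolding sum_distrib_left sum.distrib [symmetric] sum_subtractf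
    by (rule sum.cong) (auto simp: algebra_simps)
  also have "(\<Sum>i=1..e. ?w i) = int p ^ e - 1"
    using sum_geometric_weights[of 0 e "int p"] by simp
  also have "(\<Sum>i=1..e. (\<Sum>l=i..e. int (x l) - int (r l)) * ?w i) =
      (\<Sum>l=1..e. (int (x l) - int (r l)) * (int p ^ e - int p ^ (e - l)))"
    using sum_tail_sums_weights[of 0 e "\<lambda>l. int (x l) - int (r l)" "int p"] by simp
  finally show ?thesis by (simp add: gap_def algebra_simps)
qed

text \<open>In a tail without any c the rank bound is not strict, so the slacks in
  \<open>gap_eq\<close> may be -1 there. Regrouping those terms isolates \<open>2h - R(m)\<close>,
  which the weak bound controls, and the deviations of \<open>r l\<close> from
  \<open>p - 1\<close>.\<close>

lemma gap_split:
  assumes "m \<le> e" and x: "\<And>l. l \<in> {m+1..e} \<Longrightarrow> x l = 0"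
  shows "gap p e r (x, h) =
     (\<Sum>i=1..m. ((\<Sum>l=i..e. int (x l)) + 2 * int h - (\<Sum>l=i..e. int (r l)) - 1) *
       (int p ^ (e - i) * (int p - 1))) +
     (2 * int h - (\<Sum>l=m+1..e. int (r l))) * int p ^ (e - m) +
     (\<Sum>l=m+1..e. (int (r l) - (int p - 1)) * int p ^ (e - l))"
proof -
  let ?w = "\<lambda>i. int p ^ (e - i) * (int p - 1)"
  let ?z = "\<lambda>i. (\<Sum>l=i..e. int (x l)) + 2 * int h - (\<Sum>l=i..e. int (r l)) - 1"
  have "{1..e} = {1..m} \<union> {m+1..e}" using assms by auto
  then have "(\<Sum>i=1..e. ?z i * ?w i) = (\<Sum>i=1..m. ?z i * ?w i) + (\<Sum>i=m+1..e. ?z i * ?w i)"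
    by (simp add: sum.union_disjoint)
  also have "(\<Sum>i=m+1..e. ?z i * ?w i) =
      (2 * int h - 1) * (\<Sum>i=m+1..e. ?w i) - (\<Sum>i=m+1..e. (\<Sum>l=i..e. int (r l)) * ?w i)"
    unfolding sum_distrib_left sum_subtractf [symmetric]
    by (rule sum.cong) (auto simp: algebra_simps x)
  also have "(\<Sum>i=m+1..e. ?w i) = int p ^ (e - m) - 1"
    using assms by (rule_tac sum_geometric_weights)
  also have "(\<Sum>i=m+1..e. (\<Sum>l=i..e. int (r l)) * ?w i) =
      (\<Sum>l=m+1..e. int (r l) * (int p ^ (e - m) - int p ^ (e - l)))"
    using assms by (rule_tac sum_tail_sums_weights)
  also have "\<dots> = (\<Sum>l=m+1..e. int (r l)) * int p ^ (e - m) - (\<Sum>l=m+1..e. int (r l) * int p ^ (e - l))"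
    by (simp add: sum_distrib_right right_diff_distrib sum_subtractf)
  finally have 1: "(\<Sum>i=1..e. ?z i * ?w i) = (\<Sum>i=1..m. ?z i * ?w i) +
      ((2 * int h - 1) * (int p ^ (e - m) - 1) -
       ((\<Sum>l=m+1..e. int (r l)) * int p ^ (e - m) - (\<Sum>l=m+1..e. int (r l) * int p ^ (e - l))))" .
  have "(\<Sum>l=m+1..e. (int (r l) - (int p - 1)) * int p ^ (e - l)) =
      (\<Sum>l=m+1..e. int (r l) * int p ^ (e - l)) - (\<Sum>i=m+1..e. ?w i)"
    unfolding sum_subtractf [symmetric] by (rule sum.cong) (auto simp: algebra_simps)
  also have "(\<Sum>i=m+1..e. ?w i) = int p ^ (e - m) - 1"
    using assms by (rule_tac sum_geometric_weights)
  finally show ?thesis unfolding gap_eq 1 by (simp add: algebra_simps)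
qed

text \<open>If the ranks above level \<open>i\<close> all equal \<open>p - 1\<close> and
  \<open>(e - i) * (p - 1)\<close> is even, then \<open>2h\<close> is their sum, so the handles
  account for exactly the factors above level \<open>i\<close>. The guards \<open>1 \<le> k\<close>
  leave only handles for \<open>i = 0\<close>.\<close>

definition minimal_datum :: "nat \<Rightarrow> nat \<Rightarrow> (nat \<Rightarrow> nat) \<Rightarrow> nat \<Rightarrow> p_datum" where
  "minimal_datum p e r i =
     ((\<lambda>k. if 1 \<le> k \<and> k < i then r k else if 1 \<le> k \<and> k = i then r i + 1 else 0),
      (e - i) * (p - 1) div 2)"

lemma gap_minimal_datum:
  assumes m: "m \<le> e" and r: "\<And>l. l \<in> {m+1..e} \<Longrightarrow> r l = p - 1"
    and ev: "even ((e - m) * (p - 1))" and p: "1 \<le> p"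
  shows "gap p e r (minimal_datum p e r m) = 0"
proof -
  define x where "x = fst (minimal_datum p e r m)"
  define h where "h = snd (minimal_datum p e r m)"
  have x: "x l = (if 1 \<le> l \<and> l < m then r l else if 1 \<le> l \<and> l = m then r m + 1 else 0)" for l
    by (simp add: x_def minimal_datum_def)
  have h: "2 * h = (e - m) * (p - 1)" using ev by (simp add: h_def minimal_datum_def)
  have R: "(\<Sum>l=m+1..e. r l) = 2 * h" using r h by simp
  have z: "(\<Sum>l=i..e. int (x l)) + 2 * int h - (\<Sum>l=i..e. int (r l)) - 1 = 0" if i: "i \<in> {1..m}" for i
  proof -
    have split: "{i..e} = insert m {i..<m} \<union> {m+1..e}" using m i by auto
    have "(\<Sum>l=i..e. x l) = (\<Sum>l=i..<m. r l) + r m + 1"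
      unfolding split using i by (subst sum.union_disjoint) (auto simp: x)
    moreover have "(\<Sum>l=i..e. r l) = (\<Sum>l=i..<m. r l) + r m + 2 * h"
      unfolding split by (subst sum.union_disjoint) (use R in auto)
    ultimately show ?thesis unfolding of_nat_sum [symmetric] by (simp del: of_nat_sum)
  qed
  have R': "(\<Sum>l=m+1..e. int (r l)) = 2 * int h"
    using R unfolding of_nat_sum [symmetric] by (simp del: of_nat_sum)
  have "int (r l) - (int p - 1) = 0" if "l \<in> {m+1..e}" for l
    using r[OF that] p by simp
  then have D: "(\<Sum>l=m+1..e. (int (r l) - (int p - 1)) * int p ^ (e - l)) = 0"
    by simp
  have Z: "(\<Sum>i=1..m. ((\<Sum>l=i..e. int (x l)) + 2 * int h - (\<Sum>l=i..e. int (r l)) - 1) *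
      (int p ^ (e - i) * (int p - 1))) = 0"
    by (rule sum.neutral) (use z in force)
  have x0: "x l = 0" if "l \<in> {m+1..e}" for l
    using that by (simp add: x)
  have "gap p e r (x, h) = 0 + (2 * int h - 2 * int h) * int p ^ (e - m) + 0"
    by (subst gap_split[OF m x0]) (simp_all only: Z D R')
  then show ?thesis by (simp add: x_def h_def)
qed

lemma gap_nonneg_and_zero_cases:
  assumes p: "prime p" and e: "1 \<le> e"
    and r_less: "\<And>i. 1 \<le> i \<Longrightarrow> i \<le> e - 1 \<Longrightarrow> p - 1 \<le> r i"
    and r_e: "max (p - 2) 1 \<le> r e"
    and bound: "\<And>m. m < e \<Longrightarrow>
      (\<Sum>i=m+1..e. r i) + (if (\<Sum>i=m+1..e. x i) > 0 then 1 else 0) \<le> 2 * h + (\<Sum>i=m+1..e. x i)"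
    and x_out: "\<And>i. i \<notin> {1..e} \<Longrightarrow> x i = 0"
  shows "gap p e r (x, h) \<ge> 0 \<and>
    (gap p e r (x, h) = 0 \<longrightarrow>
      (\<exists>m\<le>e. (\<forall>l\<in>{m+1..e}. r l = p - 1) \<and> even ((e - m) * (p - 1)) \<and>
         (x, h) = minimal_datum p e r m))"
proof -
  \<comment> \<open>Inserting 0 covers the datum without any c; then the sum over levels up to
    \<open>m\<close> is empty.\<close>
  define m where "m = Max (insert 0 {i \<in> {1..e}. 0 < x i})"
  have fin: "finite (insert 0 {i \<in> {1..e}. 0 < x i})" by simp
  have "m \<in> insert 0 {i \<in> {1..e}. 0 < x i}" unfolding m_def using fin by (rule Max_in) simp
  then have m: "m \<le> e" "m = 0 \<or> 0 < x m" by auto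
  have x0: "x l = 0" if "l \<in> {m+1..e}" for l
  proof (rule ccontr)
    assume "x l \<noteq> 0"
    then have "l \<le> m" unfolding m_def using that fin by (intro Max_ge) auto
    then show False using that by simp
  qed
  define w where "w i = int p ^ (e - i) * (int p - 1)" for i
  define z where "z i = (\<Sum>l=i..e. int (x l)) + 2 * int h - (\<Sum>l=i..e. int (r l)) - 1" for i
  define s where "s = 2 * int h - (\<Sum>l=m+1..e. int (r l))"
  define d where "d l = int (r l) - (int p - 1)" for l
  have p2: "2 \<le> int p" using prime_ge_2_nat[OF p] by simp
  have w: "w i > 0" for i using p2 by (simp add: w_def)
  have gap: "gap p e r (x, h) =
      (\<Sum>i=1..m. z i * w i) + s * int p ^ (e - m) + (\<Sum>l=m+1..e. d l * int p ^ (e - l))"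
    unfolding z_def w_def s_def d_def using m(1) x0 by (rule gap_split)
  \<comment> \<open>A tail starting at or below \<open>m\<close> contains \<open>x m > 0\<close>, so
    the strict form of the bound applies and pays for the -1.\<close>
  have z: "0 \<le> z i" if i: "i \<in> {1..m}" for i
  proof -
    have "x m \<le> (\<Sum>l=i..e. x l)" using i m by (intro member_le_sum) auto
    then have "(\<Sum>l=i..e. x l) > 0" using m i by auto
    moreover have "i - 1 < e" "i - 1 + 1 = i" using i m by auto
    ultimately have "(\<Sum>l=i..e. r l) + 1 \<le> 2 * h + (\<Sum>l=i..e. x l)"
      using bound[of "i - 1"] by simp
    then show ?thesis unfolding z_def of_nat_sum [symmetric] by (simp del: of_nat_sum)
  qed
  have s: "0 \<le> s"
  proof (cases "m = e")
    case False
    have "(\<Sum>l=m+1..e. x l) = 0" using x0 by simp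
    then have "(\<Sum>l=m+1..e. r l) \<le> 2 * h" using bound[of m] m False by simp
    then show ?thesis unfolding s_def of_nat_sum [symmetric] by (simp del: of_nat_sum)
  qed (simp add: s_def)
  have zw: "0 \<le> z i * w i" if "i \<in> {1..m}" for i
    using z[OF that] w[of i] by simp
  have Z: "0 \<le> (\<Sum>i=1..m. z i * w i)" using zw by (rule sum_nonneg)
  show ?thesis
  proof (cases "\<forall>l\<in>{m+1..e}. p - 1 \<le> r l")
    case True
    then have d: "0 \<le> d l" if "l \<in> {m+1..e}" for l
      using that p2 unfolding d_def by fastforce
    have D: "0 \<le> (\<Sum>l=m+1..e. d l * int p ^ (e - l))"
      using d by (intro sum_nonneg) simp
    have S: "0 \<le> s * int p ^ (e - m)" using s by simp
    have "\<exists>m\<le>e. (\<forall>l\<in>{m+1..e}. r l = p - 1) \<and> even ((e - m) * (p - 1)) \<and> (x, h) = minimal_datum p e r m"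
      if "gap p e r (x, h) = 0"
    proof -
      have "(\<Sum>i=1..m. z i * w i) = 0" "s * int p ^ (e - m) = 0" "(\<Sum>l=m+1..e. d l * int p ^ (e - l)) = 0"
        using that Z D S unfolding gap by linarith+
      then have "\<forall>i\<in>{1..m}. z i * w i = 0" "s = 0" "\<forall>l\<in>{m+1..e}. d l * int p ^ (e - l) = 0"
        using sum_nonneg_eq_0_iff[of "{1..m}" "\<lambda>i. z i * w i"] zw p2
          sum_nonneg_eq_0_iff[of "{m+1..e}" "\<lambda>l. d l * int p ^ (e - l)"] d by auto
      then have s0: "s = 0" and d0: "\<forall>l\<in>{m+1..e}. d l = 0" and z0: "\<forall>i\<in>{1..m}. z i = 0"
        using w p2 by (auto simp: less_le)
      have r: "r l = p - 1" if "l \<in> {m+1..e}" for l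
        using bspec[OF d0 that] p2 unfolding d_def by linarith
      then have R: "(\<Sum>l=m+1..e. r l) = (e - m) * (p - 1)" by simp
      then have "int (2 * h) = int ((e - m) * (p - 1))"
        using s0 unfolding s_def of_nat_sum [symmetric] by (simp del: of_nat_sum)
      then have h: "2 * h = (e - m) * (p - 1)" by (simp only: of_nat_eq_iff)
      \<comment> \<open>Consecutive tail equations differ by one term, which yields
        \<open>x l = r l\<close> below \<open>m\<close>; the equation at \<open>m\<close> itself
        yields \<open>r m + 1\<close>.\<close>
      have zeq: "(\<Sum>l=i..e. x l) + 2 * h = (\<Sum>l=i..e. r l) + 1" if "i \<in> {1..m}" for i
        using bspec[OF z0 that] unfolding z_def of_nat_sum [symmetric] by (simp del: of_nat_sum)
      have "x l = fst (minimal_datum p e r m) l" for l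
      proof -
        consider "l \<notin> {1..e}" | "l \<in> {m+1..e}" | "l = m" "1 \<le> m" | "1 \<le> l" "l < m"
          using m by (cases "l < m") fastforce+
        then show ?thesis
        proof cases
          case 1
          then show ?thesis using x_out m by (auto simp: minimal_datum_def)
        next
          case 2
          then show ?thesis using x0 by (auto simp: minimal_datum_def)
        next
          case 3
          have "(\<Sum>l=m..e. x l) = x m" "(\<Sum>l=m..e. r l) = r m + 2 * h"
            using m x0 R h by (simp_all add: sum.atLeast_Suc_atMost)
          then show ?thesis using zeq[of m] 3 by (simp add: minimal_datum_def)
        next
          case 4
          then have "(\<Sum>l=l..e. x l) = x l + (\<Sum>l=Suc l..e. x l)" "(\<Sum>l=l..e. r l) = r l + (\<Sum>l=Suc l..e. r l)"
            using m by (simp_all add: sum.atLeast_Suc_atMost)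
          then show ?thesis using zeq[of l] zeq[of "Suc l"] 4 by (simp add: minimal_datum_def)
        qed
      qed
      then have "(x, h) = minimal_datum p e r m"
        using h by (auto simp: prod_eq_iff minimal_datum_def)
      moreover have "even ((e - m) * (p - 1))" using h by (metis dvd_triv_left)
      ultimately show ?thesis using m r by blast
    qed
    moreover have "gap p e r (x, h) \<ge> 0" unfolding gap using Z D S by linarith
    ultimately show ?thesis by blast
  next
    case False
    have "m < e" using False m by (cases "m = e") auto
    have r_mid: "p - 1 \<le> r l" if "l \<in> {m+1..<e}" for l
      using r_less[of l] that by auto
    have e': "{m+1..e} = insert e {m+1..<e}" using \<open>m < e\<close> by auto
    \<comment> \<open>Below \<open>e\<close> the ranks are at least \<open>p - 1\<close>, so the
      failure occurs at \<open>e\<close>; together with \<open>r e \<ge> 1\<close> this excludes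
      \<open>p = 2\<close>.\<close>
    have "r e < p - 1" using False r_mid unfolding e' by auto
    then have r_e': "r e = p - 2" "3 \<le> p" using r_e by auto
    have "odd p" using prime_odd_nat[OF p] r_e'(2) by simp
    have "d e = - 1" using r_e' by (simp add: d_def)
    have d: "0 \<le> d l" if "l \<in> {m+1..<e}" for l
      using r_mid[OF that] p2 unfolding d_def by linarith
    have D_split: "(\<Sum>l=m+1..e. d l * int p ^ (e - l)) = (\<Sum>l=m+1..<e. d l * int p ^ (e - l)) - 1"
      unfolding e' using \<open>d e = - 1\<close> by simp
    have "0 < gap p e r (x, h)"
    proof (rule ccontr)
      assume "\<not> 0 < gap p e r (x, h)"
      \<comment> \<open>The level \<open>e\<close> contributes exactly -1, so a gap that is not
        positive leaves a budget of 1 for all the other nonnegative terms.\<close>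
      then have le: "s * int p ^ (e - m) + (\<Sum>l=m+1..<e. d l * int p ^ (e - l)) \<le> 1"
        unfolding gap D_split using Z by linarith
      have D: "0 \<le> (\<Sum>l=m+1..<e. d l * int p ^ (e - l))"
        using d by (intro sum_nonneg) simp
      have pow: "2 \<le> int p ^ (e - l)" if "l < e" for l
        using self_le_power[of "int p" "e - l"] that p2 by linarith
      \<comment> \<open>For \<open>l < e\<close> the weight is at least 2, so any positive multiple
        of it exceeds this budget.\<close>
      have small: "a = 0" if "0 \<le> a" "a * int p ^ (e - l) \<le> 1" "l < e" for a l
      proof (rule ccontr)
        assume "a \<noteq> 0"
        then have "1 * 2 \<le> a * int p ^ (e - l)"
          using that pow[of l] by (intro mult_mono) auto
        then show False using that by simp
      qed
      have s0: "s = 0"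
        using small[of s m] s le D \<open>m < e\<close> by linarith
      have "d l = 0" if "l \<in> {m+1..<e}" for l
      proof -
        have "d l * int p ^ (e - l) \<le> (\<Sum>l=m+1..<e. d l * int p ^ (e - l))"
          using that d by (intro member_le_sum) auto
        then show ?thesis using small[of "d l" l] d[OF that] le s0 that by simp
      qed
      then have "(\<Sum>l=m+1..<e. int (r l)) = (\<Sum>l=m+1..<e. int p - 1)"
        by (intro sum.cong) (auto simp: d_def)
      \<comment> \<open>The right side is odd: \<open>p - 1\<close> is even and \<open>p - 2\<close>
        is odd. This is the parity contradiction.\<close>
      then have "2 * int h = int (e - m - 1) * (int p - 1) + (int p - 2)"
        using s0 r_e' unfolding s_def e' by simp
      moreover have "even (int p - 1)" "odd (int p - 2)" using \<open>odd p\<close> by auto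
      ultimately have "odd (2 * int h)" by (metis odd_add even_mult_iff)
      then show False by simp
    qed
    then show ?thesis by simp
  qed
qed

section \<open>Data for every larger value\<close>

text \<open>Only the digits from 2 to \<open>e\<close> are bounded; \<open>z 1\<close> absorbs the
  whole remaining quotient, so finitely many places suffice for every \<open>M\<close>. The residue
  of the last digit is kept for the parity of \<open>x e\<close>.\<close>

lemma base_p_digits:
  fixes p e M :: nat
  assumes "1 \<le> e" "0 < p"
  shows "\<exists>z. (\<Sum>i=1..e. z i * p ^ (e - i)) = M \<and> (\<forall>i\<in>{2..e}. z i < p) \<and> z e mod p = M mod p"
  using assms(1)
proof (induction e arbitrary: M rule: nat_induct_at_least)
  case base
  show ?case by (rule exI[of _ "\<lambda>_. M"]) simp
next
  case (Suc e)
  obtain z where z: "(\<Sum>i=1..e. z i * p ^ (e - i)) = M div p" "\<forall>i\<in>{2..e}. z i < p"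
    using Suc.IH[of "M div p"] by blast
  let ?z = "z(Suc e := M mod p)"
  have "(\<Sum>i=1..e. ?z i * p ^ (Suc e - i)) = (\<Sum>i=1..e. p * (z i * p ^ (e - i)))"
    by (rule sum.cong) (auto simp: Suc_diff_le)
  also have "\<dots> = p * (M div p)" using z(1) by (simp flip: sum_distrib_left)
  finally have "(\<Sum>i=1..Suc e. ?z i * p ^ (Suc e - i)) = M" by simp
  moreover have "\<forall>i\<in>{2..Suc e}. ?z i < p" using z(2) assms(2) by (auto simp: le_Suc_eq)
  ultimately show ?case by (intro exI[of _ ?z]) simp
qed

text \<open>By \<open>gap_eq\<close> the gap is \<open>2h + (p - 1)\<close> times the number with
  digits \<open>z i\<close>, where the \<open>z i\<close> are the slacks. The clauses after the gap
  are the input of the realization: a basis element at level \<open>e\<close> left over by the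
  handles, two c at that level, and the parity needed for \<open>p = 2\<close>.\<close>

lemma datum_with_gap:
  assumes p: "prime p" and e: "1 \<le> e"
    and r_less: "\<And>i. 1 \<le> i \<Longrightarrow> i \<le> e - 1 \<Longrightarrow> p - 1 \<le> r i"
    and r_e: "max (p - 2) 1 \<le> r e"
    and even_N: "odd p \<or> r e = 1 \<Longrightarrow> even N"
  shows "\<exists>x h. gap p e r (x, h) = int N \<and> (\<forall>i. i \<notin> {1..e} \<longrightarrow> x i = 0) \<and>
    2 * h < r e \<and> 2 \<le> x e \<and> (p = 2 \<longrightarrow> h = 0) \<and> (p = 2 \<and> r e = 1 \<longrightarrow> even (x e)) \<and>
    (\<forall>i\<in>{1..e}. (\<Sum>l=i..e. r l) + 1 \<le> 2 * h + (\<Sum>l=i..e. x l))"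
proof -
  have p2: "2 \<le> p" using p by (rule prime_ge_2_nat)
  define h where "h = N mod (p - 1) div 2"
  define M where "M = N div (p - 1)"
  have odd_p: "odd p" if "p \<noteq> 2"
    using that p primes_dvd_imp_eq two_is_prime_nat by blast
  have h2: "2 * h = N mod (p - 1)"
  proof (cases "p = 2")
    case False
    then have "even N" "even (p - 1)" using odd_p even_N by auto
    then have "even (N mod (p - 1))" by (metis dvd_mod)
    then show ?thesis by (simp add: h_def)
  qed (simp add: h_def)
  have h_le: "2 * h < r e"
  proof (cases "p = 2")
    case True
    then show ?thesis using h2 r_e by simp
  next
    case False
    then have "even (p - 1)" using odd_p p2 by auto
    moreover have "2 * h < p - 1" unfolding h2 using p2 by (intro mod_less_divisor) simp
    \<comment> \<open>Two even numbers differ by at least 2, so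
      \<open>2 * h \<le> p - 3\<close>.\<close>
    ultimately have "2 * h < p - 2" by (metis (no_types, lifting) Suc_diff_Suc dvd_triv_left even_Suc
          less_antisym numeral_2_eq_2 p2 One_nat_def Suc_1 diff_Suc_1 Suc_le_lessD)
    then show ?thesis using r_e by simp
  qed
  obtain z where z: "(\<Sum>i=1..e. z i * p ^ (e - i)) = M" "\<forall>i\<in>{2..e}. z i < p" "z e mod p = M mod p"
    using base_p_digits[OF e, of p M] p2 by auto
  \<comment> \<open>Solves for slack \<open>z i\<close> at every level by taking differences of
    consecutive tails. The natural subtraction is exact:
    \<open>z (Suc i) \<le> p - 1 \<le> r i\<close> below \<open>e\<close>, and
    \<open>2 * h < r e\<close> at \<open>e\<close>, which also gives
    \<open>x e \<ge> 2\<close>.\<close>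
  define x where "x i = (if i \<notin> {1..e} then 0 else if i = e then z e + r e + 1 - 2 * h
      else z i + r i - z (Suc i))" for i
  have X: "(\<Sum>l=i..e. int (x l)) = int (z i) + (\<Sum>l=i..e. int (r l)) + 1 - 2 * int h"
    if "i \<in> {1..e}" for i
  proof -
    have "i \<le> e" using that by simp
    then show ?thesis using that
    proof (induction rule: inc_induct)
      case base
      then show ?case using h_le by (simp add: x_def)
    next
      case (step i)
      then have "z (Suc i) < p" "p - 1 \<le> r i" using z(2) r_less[of i] by auto
      then have "int (x i) = int (z i) + int (r i) - int (z (Suc i))"
        using step p2 by (simp add: x_def)
      then show ?case using step by (simp add: sum.atLeast_Suc_atMost[of i])
    qed
  qed
  have "gap p e r (x, h) = 2 * int h + (\<Sum>i=1..e. int (z i) * (int p ^ (e - i) * (int p - 1)))"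
    unfolding gap_eq by (simp add: X)
  also have "(\<Sum>i=1..e. int (z i) * (int p ^ (e - i) * (int p - 1))) =
      int M * (int p - 1)"
    unfolding z(1) [symmetric] by (simp add: sum_distrib_right mult.assoc)
  also have "2 * int h + \<dots> = int (2 * h + M * (p - 1))"
    using p2 by (simp add: of_nat_diff)
  also have "2 * h + M * (p - 1) = N" unfolding h2 M_def by (rule mod_div_mult_eq)
  finally have gap: "gap p e r (x, h) = int N" .
  have "2 \<le> x e" using h_le e by (simp add: x_def)
  moreover have "p = 2 \<longrightarrow> h = 0" by (simp add: h_def)
  \<comment> \<open>Here \<open>p - 1 = 1\<close>, so \<open>M = N\<close> and \<open>h = 0\<close>;
    thus \<open>x e = z e + 2\<close>, and \<open>z e\<close> has the parity of
    \<open>N\<close>.\<close>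
  moreover have "even (x e)" if "p = 2" "r e = 1"
  proof -
    have "even N" using even_N that by simp
    then have "even (z e)" using z(3) that(1) by (simp add: M_def even_iff_mod_2_eq_zero)
    then show ?thesis using that e by (simp add: x_def h_def)
  qed
  moreover have "(\<Sum>l=i..e. r l) + 1 \<le> 2 * h + (\<Sum>l=i..e. x l)" if "i \<in> {1..e}" for i
    using X[OF that] unfolding of_nat_sum [symmetric] by linarith
  moreover have "\<forall>i. i \<notin> {1..e} \<longrightarrow> x i = 0" by (simp add: x_def)
  ultimately show ?thesis using gap h_le by blast
qed

section \<open>Construction of smooth epimorphisms\<close>

text \<open>Hall's condition for thresholds suffices greedily. The element \<open>b\<close> with the
  largest \<open>f\<close> takes any \<open>c\<close> with \<open>f b \<le> g c\<close>. Every
  threshold up to \<open>f b\<close> then loses one element on each side, and beyond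
  \<open>f b\<close> nothing is left to match.\<close>

lemma level_matching:
  fixes f :: "'b \<Rightarrow> nat" and g :: "'c \<Rightarrow> nat"
  assumes "finite B" "finite C" "\<And>i. card {b \<in> B. i \<le> f b} \<le> card {c \<in> C. i \<le> g c}"
  shows "\<exists>\<mu>. inj_on \<mu> B \<and> \<mu> ` B \<subseteq> C \<and> (\<forall>b\<in>B. f b \<le> g (\<mu> b))"
  using assms
proof (induction B arbitrary: C rule: finite_ranking_induct[where f = f])
  case empty
  show ?case by simp
next
  case (insert b B)
  show ?case
  proof (cases "b \<in> B")
    case True
    then show ?thesis using insert by (simp add: insert_absorb)
  next
    case False
    have "b \<in> {b' \<in> insert b B. f b \<le> f b'}" by simp
    then have "card {b' \<in> insert b B. f b \<le> f b'} > 0"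
      using insert.hyps by (intro card_gt_0_iff[THEN iffD2]) auto
    then have "card {c \<in> C. f b \<le> g c} > 0" using insert.prems(2)[of "f b"] by linarith
    then obtain c where c: "c \<in> C" "f b \<le> g c" by (auto simp: card_gt_0_iff)
    have "card {b' \<in> B. i \<le> f b'} \<le> card {c' \<in> C - {c}. i \<le> g c'}" for i
    proof (cases "i \<le> f b")
      case True
      have "{b' \<in> insert b B. i \<le> f b'} = insert b {b' \<in> B. i \<le> f b'}" using True by auto
      then have "card {b' \<in> insert b B. i \<le> f b'} = Suc (card {b' \<in> B. i \<le> f b'})"
        using False insert.hyps by simp
      moreover have "{c' \<in> C. i \<le> g c'} = insert c {c' \<in> C - {c}. i \<le> g c'}" using True c by auto
      then have "card {c' \<in> C. i \<le> g c'} = Suc (card {c' \<in> C - {c}. i \<le> g c'})"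
        using insert.prems(1) by simp
      ultimately show ?thesis using insert.prems(2)[of i] by simp
    next
      case False
      then have "{b' \<in> B. i \<le> f b'} = {}" using insert.hyps by fastforce
      then show ?thesis by (metis card.empty zero_le)
    qed
    then obtain \<mu> where \<mu>: "inj_on \<mu> B" "\<mu> ` B \<subseteq> C - {c}" "\<forall>b\<in>B. f b \<le> g (\<mu> b)"
      using insert.IH[of "C - {c}"] insert.prems(1) by auto
    have "inj_on (\<mu>(b := c)) (insert b B)"
      using \<mu> False by (auto simp: inj_on_def image_subset_iff)
    moreover have "(\<mu>(b := c)) ` insert b B \<subseteq> C" using \<mu>(2) c by auto
    moreover have "\<forall>b'\<in>insert b B. f b' \<le> g ((\<mu>(b := c)) b')" using \<mu>(3) c by auto
    ultimately show ?thesis by blast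
  qed
qed

text \<open>All ones work unless \<open>p\<close> divides \<open>1 + card D\<close>. In that case
  replacing a single 1 by 2 shifts the sum to 1 modulo \<open>p\<close>, and 2 is a unit for odd
  \<open>p\<close>. For \<open>p = 2\<close> an even \<open>card D\<close> excludes this
  case.\<close>

lemma units_with_unit_sum:
  fixes p :: nat
  assumes "prime p" "finite D" "odd p \<or> even (card D)"
  shows "\<exists>u :: 'c \<Rightarrow> int. (\<forall>c. \<not> int p dvd u c) \<and> \<not> int p dvd 1 + (\<Sum>c\<in>D. u c)"
proof (cases "int p dvd 1 + int (card D)")
  case False
  have "\<not> int p dvd 1" using prime_gt_1_nat[OF assms(1)] by (simp add: zdvd1_eq)
  then show ?thesis using False by (intro exI[of _ "\<lambda>_. 1"]) simp
next
  case True
  have one: "\<not> int p dvd 1" using prime_gt_1_nat[OF assms(1)] by (simp add: zdvd1_eq)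
  have "D \<noteq> {}" using True one by auto
  then obtain c0 where c0: "c0 \<in> D" by blast
  have "odd p"
  proof (rule ccontr)
    assume "\<not> odd p"
    then have "even (card D)" "even (int p)" using assms(3) by auto
    moreover from this(2) True have "even (1 + int (card D))" by (rule dvd_trans)
    ultimately show False by simp
  qed
  then have two: "\<not> int p dvd 2"
  proof -
    have "2 < p" using prime_gt_1_nat[OF assms(1)] \<open>odd p\<close> by (cases "p = 2") auto
    then show ?thesis using zdvd_imp_le[of "int p" 2] by auto
  qed
  define u :: "'c \<Rightarrow> int" where "u c = (if c = c0 then 2 else 1)" for c
  have "u c0 = 2" by (simp add: u_def)
  then have "(\<Sum>c\<in>D. u c) = 2 + (\<Sum>c\<in>D - {c0}. u c)"
    using sum.remove[OF assms(2) c0, of u] by simp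
  also have "(\<Sum>c\<in>D - {c0}. u c) = int (card D) - 1"
  proof -
    have "card D > 0" using c0 assms(2) by (auto simp: card_gt_0_iff)
    moreover have "(\<Sum>c\<in>D - {c0}. u c) = (\<Sum>c\<in>D - {c0}. 1)"
      by (rule sum.cong) (auto simp: u_def)
    ultimately show ?thesis using c0 by (simp add: card_Diff_singleton of_nat_diff)
  qed
  finally have "1 + (\<Sum>c\<in>D. u c) = 1 + (1 + int (card D))" by simp
  then have "\<not> int p dvd 1 + (\<Sum>c\<in>D. u c)"
    using one True by (metis dvd_add_left_iff)
  then show ?thesis using one two by (intro exI[of _ u]) (simp add: u_def)
qed

text \<open>An exact identity of integer vectors, not one modulo the orders, with coefficients
  common to all coordinates.\<close>

definition combination :: "('s \<Rightarrow> 'q \<Rightarrow> int) \<Rightarrow> 's set \<Rightarrow> ('q \<Rightarrow> int) \<Rightarrow> bool" where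
  "combination f S w \<longleftrightarrow> (\<exists>n. \<forall>q. w q = (\<Sum>s\<in>S. n s * f s q))"

lemma combination_generator: "finite S \<Longrightarrow> s \<in> S \<Longrightarrow> combination f S (f s)"
  unfolding combination_def
  by (rule exI[of _ "\<lambda>s'. if s' = s then 1 else 0"]) (simp add: if_distrib[of "\<lambda>a. a * _"] cong: if_cong)

lemma combination_scaled_add:
  assumes "combination f S v" "combination f S w"
  shows "combination f S (\<lambda>q. v q + a * w q)"
proof -
  obtain n n' where "\<forall>q. v q = (\<Sum>s\<in>S. n s * f s q)" "\<forall>q. w q = (\<Sum>s\<in>S. n' s * f s q)"
    using assms unfolding combination_def by blast
  then have "\<forall>q. v q + a * w q = (\<Sum>s\<in>S. (n s + a * n' s) * f s q)"
    by (simp add: distrib_right sum.distrib sum_distrib_left mult.assoc)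
  then show ?thesis unfolding combination_def by (rule exI[of _ "\<lambda>s. n s + a * n' s"])
qed

lemma combination_sum:
  assumes "finite B" "\<And>b. b \<in> B \<Longrightarrow> combination f S (w b)"
  shows "combination f S (\<lambda>q. \<Sum>b\<in>B. a b * w b q)"
  using assms
proof (induction B)
  case empty
  show ?case unfolding combination_def by (rule exI[of _ "\<lambda>_. 0"]) simp
next
  case (insert b B)
  then show ?case
    using combination_scaled_add[of f S "\<lambda>q. \<Sum>b\<in>B. a b * w b q" "w b" "a b"]
    by (simp add: add.commute)
qed

context abelian_coordinates
begin

definition basis :: "nat \<times> nat \<Rightarrow> nat \<times> nat \<Rightarrow> int" where
  "basis b q = (if q = b then 1 else 0)"

text \<open>Product relation and generation are demanded over the integers, which implies them in
  \<open>G\<close> and keeps congruences out of the constructions.\<close>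

lemma realizesI:
  assumes "\<And>i k. i \<in> {1..e} \<Longrightarrow> k \<in> {1..x i} \<Longrightarrow> ord (E (f (GenC i k))) = p ^ i"
    and "\<And>q. (\<Sum>c\<in>(SIGMA i:{1..e}. {1..x i}). f (GenC (fst c) (snd c)) q) = 0"
    and "\<And>b. b \<in> (SIGMA i:{1..e}. {1..r i}) \<Longrightarrow> combination f (Gamma_generators e (x, h)) (basis b)"
  shows "realizes (x, h) f"
  unfolding realizes_def
proof (intro conjI ballI allI)
  show "ord (E (f (GenC i k))) = p ^ i" if "i \<in> {1..e}" "k \<in> {1..fst (x, h) i}" for i k
    using assms(1) that by simp
  have "(\<Sum>i=1..e. \<Sum>k=1..x i. f (GenC i k) q) = 0" for q
    using assms(2)[of q] by (simp add: sum.Sigma case_prod_beta')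
  then show "E (\<lambda>q. \<Sum>i=1..e. \<Sum>k=1..fst (x, h) i. f (GenC i k) q) = \<one>" by simp
next
  fix v
  let ?I = "SIGMA i:{1..e}. {1..r i}"
  have "combination f (Gamma_generators e (x, h)) (\<lambda>q. \<Sum>b\<in>?I. v b * basis b q)"
    by (intro combination_sum assms(3)) auto
  then obtain n where n: "\<forall>q. (\<Sum>b\<in>?I. v b * basis b q) = (\<Sum>s\<in>Gamma_generators e (x, h). n s * f s q)"
    unfolding combination_def by blast
  have "(\<Sum>b\<in>?I. v b * basis b q) = v q" if "q \<in> ?I" for q
    using that by (simp add: basis_def if_distrib[of "\<lambda>a. _ * a"] cong: if_cong)
  then have "E v = E (\<lambda>q. \<Sum>s\<in>Gamma_generators e (x, h). n s * f s q)"
    unfolding E_eq_iff using n by auto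
  then show "\<exists>n. E v = E (\<lambda>q. \<Sum>s\<in>Gamma_generators e (x, h). n s * f s q)" by (rule exI[of _ n])
qed

text \<open>The handles carry the basis elements outside \<open>I'\<close>; each element of
  \<open>I'\<close> is carried by its partner under \<mu>. The spare \<open>c0\<close> of maximal
  level is determined by the product relation. Since \<open>b1\<close> and its partner have the same
  level, \<open>basis b1\<close> is hit exactly, so multiples of it can be added to correct orders
  and later removed. The hypothesis \<open>alt\<close> secures the order of the image of
  \<open>c0\<close>.\<close>

lemma realizes_of_matching:
  fixes x :: "nat \<Rightarrow> nat" and h :: nat
  defines "I \<equiv> SIGMA i:{1..e}. {1..r i}" and "C \<equiv> SIGMA i:{1..e}. {1..x i}"
  assumes I': "I' \<subseteq> I" "card (I - I') \<le> 2 * h"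
    and c0: "c0 \<in> C" "\<And>c. c \<in> C \<Longrightarrow> fst c \<le> fst c0"
    and b1: "b1 \<in> I'" "fst b1 = fst c0"
    and \<mu>: "inj_on \<mu> I'" "\<mu> ` I' \<subseteq> C - {c0}" "\<And>b. b \<in> I' \<Longrightarrow> fst b \<le> fst (\<mu> b)"
    and alt: "(\<exists>b2\<in>I'. b2 \<noteq> b1 \<and> fst b2 = fst c0) \<or> odd p \<or> even (x (fst c0))"
  shows "\<exists>f. realizes (x, h) f"
proof -
  define M where "M = fst c0"
  have p0: "int p > 0" using prime_gt_0_nat[OF prime_p] by simp
  have fin: "finite I" "finite C" "finite I'"
    using I' by (auto simp: I_def C_def intro: finite_subset)
  have M: "1 \<le> M" "M \<le> e" using c0 by (auto simp: M_def C_def)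
  have level: "fst b \<le> M" if "b \<in> I'" for b
  proof -
    have "\<mu> b \<in> C" using \<mu>(2) that by blast
    then show ?thesis unfolding M_def using \<mu>(3)[OF that] c0(2) by (metis le_trans)
  qed
  \<comment> \<open>The remaining c of top level. If \<open>b1\<close> is the only element of
    \<open>I'\<close> at that level, the image of \<open>c0\<close> has \<open>b1\<close>-coordinate
    -(1 + sum of \<open>u\<close> over \<open>D\<close>) modulo \<open>p\<close>.\<close>
  define D where "D = {c \<in> C. fst c = M} - {c0, \<mu> b1}"
  have \<mu>b1: "\<mu> b1 \<in> C" "\<mu> b1 \<noteq> c0" "fst (\<mu> b1) = M"
  proof -
    show "\<mu> b1 \<in> C" "\<mu> b1 \<noteq> c0" using \<mu>(2) b1(1) by blast+
    then show "fst (\<mu> b1) = M" using \<mu>(3)[OF b1(1)] b1(2) c0(2) unfolding M_def by (metis le_antisym)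
  qed
  have card_level: "card {c \<in> C. fst c = M} = x M"
  proof -
    have "{c \<in> C. fst c = M} = Pair M ` {1..x M}" using M by (auto simp: C_def)
    then show ?thesis by (simp add: card_image inj_on_def)
  qed
  have card_D: "card D = x M - 2" "2 \<le> x M"
  proof -
    have sub: "{c0, \<mu> b1} \<subseteq> {c \<in> C. fst c = M}" using c0 \<mu>b1 by (auto simp: M_def)
    have "card {c0, \<mu> b1} = 2" using \<mu>b1 by auto
    then show "card D = x M - 2" "2 \<le> x M"
      using card_level card_Diff_subset[OF _ sub] card_mono[OF _ sub] fin by (auto simp: D_def)
  qed
  have "finite D" using fin by (simp add: D_def)
  have "\<exists>u :: nat \<times> nat \<Rightarrow> int. (\<forall>c. \<not> int p dvd u c) \<and>
      ((\<exists>b2\<in>I'. b2 \<noteq> b1 \<and> fst b2 = M) \<or> \<not> int p dvd 1 + (\<Sum>c\<in>D. u c))"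
  proof (cases "\<exists>b2\<in>I'. b2 \<noteq> b1 \<and> fst b2 = M")
    case True
    have "\<not> int p dvd 1" using prime_gt_1_nat[OF prime_p] by (simp add: zdvd1_eq)
    then show ?thesis using True by (intro exI[of _ "\<lambda>_. 1"]) auto
  next
    case False
    then have "odd p \<or> even (card D)" using alt card_D by (auto simp: M_def)
    then show ?thesis using units_with_unit_sum[OF prime_p \<open>finite D\<close>] by blast
  qed
  then obtain u :: "nat \<times> nat \<Rightarrow> int" where u: "\<And>c. \<not> int p dvd u c"
    and u_sum: "(\<exists>b2\<in>I'. b2 \<noteq> b1 \<and> fst b2 = M) \<or> \<not> int p dvd 1 + (\<Sum>c\<in>D. u c)"
    by blast
  define \<beta> where "\<beta> = inv_into I' \<mu>"
  have \<beta>: "\<beta> (\<mu> b) = b" if "b \<in> I'" for b using \<mu>(1) that by (simp add: \<beta>_def)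
  \<comment> \<open>Adding \<open>t c * basis b1\<close> raises the order of the image to \<open>p ^ fst c\<close>. The units \<open>u\<close> are chosen
     so that the last image \<open>V c0\<close>, which is forced by the product relation, still has order \<open>p ^ M\<close>.\<close>
  define t where "t c = (if c \<in> \<mu> ` I' \<and> fst c = fst (\<beta> c) then 0 else u c * int p ^ (M - fst c))" for c
  define V' where "V' c q = (if c \<in> \<mu> ` I' then basis (\<beta> c) q else 0) + t c * basis b1 q" for c q
  define V where "V c q = (if c = c0 then - (\<Sum>c\<in>C - {c0}. V' c q) else V' c q)" for c q
  have V'_kill: "int p ^ fst q dvd int p ^ fst c * V' c q" if "c \<in> C" for c q
  proof -
    have "int p ^ fst q dvd int p ^ fst c * (if c \<in> \<mu> ` I' then basis (\<beta> c) q else 0)"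
      using \<mu>(3) \<beta> by (auto simp: basis_def intro: le_imp_power_dvd)
    moreover have "int p ^ fst q dvd int p ^ fst c * (t c * basis b1 q)"
    proof (cases "t c = 0 \<or> q \<noteq> b1")
      case False
      then have "int p ^ fst c * (t c * basis b1 q) = u c * (int p ^ fst c * int p ^ (M - fst c))"
        by (auto simp: t_def basis_def)
      also have "int p ^ fst c * int p ^ (M - fst c) = int p ^ fst q"
        using c0(2)[OF that] False b1 by (simp add: M_def flip: power_add)
      finally show ?thesis by simp
    qed (auto simp: basis_def)
    ultimately show ?thesis unfolding V'_def distrib_left by (rule dvd_add)
  qed
  have not_dvd: "\<not> int p ^ i dvd int p ^ (i - 1) * a" if "\<not> int p dvd a" "1 \<le> i" for i a
  proof
    assume *: "int p ^ i dvd int p ^ (i - 1) * a"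
    have "int p ^ i = int p ^ (i - 1) * int p" using that(2) by (metis power_minus_mult Suc_le_eq One_nat_def)
    with * that p0 show False by simp
  qed
  have one: "\<not> int p dvd 1" using prime_gt_1_nat[OF prime_p] by (simp add: zdvd1_eq)
  \<comment> \<open>The order is witnessed by the coordinate 1 at the matched basis element if the
    levels agree, and otherwise by the correction in coordinate \<open>b1\<close>.\<close>
  have V'_alive: "\<exists>q\<in>I. \<not> int p ^ fst q dvd int p ^ (fst c - 1) * V' c q" if c: "c \<in> C" for c
  proof (cases "c \<in> \<mu> ` I' \<and> fst c = fst (\<beta> c)")
    case True
    then obtain b where b: "b \<in> I'" "c = \<mu> b" by blast
    then have "V' c b = 1" using True \<beta> by (simp add: V'_def t_def basis_def)
    moreover have "fst b = fst c" using True b \<beta> by simp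
    moreover have "1 \<le> fst c" using c by (auto simp: C_def)
    ultimately show ?thesis using b I' not_dvd[OF one, of "fst c"] by (intro bexI[of _ b]) auto
  next
    case False
    \<comment> \<open>The partner of \<open>b1\<close> has the level of \<open>b1\<close>, so it
      belongs to the uncorrected case.\<close>
    have "\<beta> c \<noteq> b1" if "c \<in> \<mu> ` I'"
    proof
      assume "\<beta> c = b1"
      with that \<beta> have "c = \<mu> b1" by auto
      then show False using False b1 \<mu>b1 \<open>\<beta> c = b1\<close> by (auto simp: M_def)
    qed
    then have "V' c b1 = u c * int p ^ (M - fst c)"
      using False by (auto simp: V'_def t_def basis_def)
    moreover have "int p ^ (fst c - 1) * int p ^ (M - fst c) = int p ^ (M - 1)"
    proof -
      have "1 \<le> fst c" "fst c \<le> M" using c c0(2) by (auto simp: C_def M_def)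
      then show ?thesis by (simp flip: power_add)
    qed
    ultimately have "int p ^ (fst c - 1) * V' c b1 = int p ^ (M - 1) * u c" by simp
    then show ?thesis using not_dvd[OF u, of M c] M b1 I' by (intro bexI[of _ b1]) (auto simp: M_def)
  qed
  have ordI: "ord (E (V c)) = p ^ fst c"
    if *: "1 \<le> fst c" "\<And>q. int p ^ fst q dvd int p ^ fst c * V c q"
      "\<exists>q\<in>I. \<not> int p ^ fst q dvd int p ^ (fst c - 1) * V c q" for c
    unfolding ord_E_iff[OF *(1)]
  proof
    show "\<forall>i\<in>{1..e}. \<forall>k\<in>{1..r i}. int p ^ i dvd int p ^ fst c * V c (i, k)"
      using *(2) by (metis fst_conv)
    obtain q where "q \<in> I" "\<not> int p ^ fst q dvd int p ^ (fst c - 1) * V c q" using *(3) by blast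
    then show "\<exists>i\<in>{1..e}. \<exists>k\<in>{1..r i}. \<not> int p ^ i dvd int p ^ (fst c - 1) * V c (i, k)"
      by (intro bexI[of _ "fst q"] bexI[of _ "snd q"]) (auto simp: I_def)
  qed
  have sum_alive: "\<exists>b\<in>I. fst b = M \<and> \<not> int p dvd (\<Sum>c\<in>C - {c0}. V' c b)"
  proof (cases "\<exists>b2\<in>I'. b2 \<noteq> b1 \<and> fst b2 = M")
    case True
    then obtain b2 where b2: "b2 \<in> I'" "b2 \<noteq> b1" "fst b2 = M" by blast
    \<comment> \<open>Corrections affect only the coordinate \<open>b1\<close>, so coordinate
      \<open>b2\<close> sees nothing but the partner of \<open>b2\<close>.\<close>
    have "V' c b2 = (if c = \<mu> b2 then 1 else 0)" for c
      using b2 \<beta> by (auto simp: V'_def basis_def)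
    then have "(\<Sum>c\<in>C - {c0}. V' c b2) = 1"
      using fin \<mu>(2) b2 by (simp add: image_subset_iff)
    then show ?thesis using one b2 I' by (intro bexI[of _ b2]) auto
  next
    case False
    have sum: "(\<Sum>c\<in>C - {c0}. V' c b1) = 1 + (\<Sum>c\<in>C - {c0, \<mu> b1}. V' c b1)"
    proof -
      have "(\<Sum>c\<in>C - {c0}. V' c b1) = V' (\<mu> b1) b1 + (\<Sum>c\<in>C - {c0} - {\<mu> b1}. V' c b1)"
        using fin \<mu>b1 by (intro sum.remove) auto
      moreover have "C - {c0} - {\<mu> b1} = C - {c0, \<mu> b1}" by auto
      moreover have "V' (\<mu> b1) b1 = 1"
        using b1 \<beta> \<mu>b1 by (simp add: V'_def basis_def t_def M_def)
      ultimately show ?thesis by simp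
    qed
    have D_sub: "D \<subseteq> C - {c0, \<mu> b1}" by (auto simp: D_def)
    have V'_t: "V' c b1 = t c" if "c \<in> C - {c0, \<mu> b1}" for c
      using that \<beta> by (auto simp: V'_def basis_def)
    have "(\<Sum>c\<in>C - {c0, \<mu> b1}. V' c b1) =
        (\<Sum>c\<in>D. V' c b1) + (\<Sum>c\<in>C - {c0, \<mu> b1} - D. V' c b1)"
      using sum.subset_diff[OF D_sub] fin by (simp add: add.commute)
    also have "(\<Sum>c\<in>D. V' c b1) = (\<Sum>c\<in>D. u c)"
    proof (rule sum.cong)
      fix c assume c: "c \<in> D"
      have "fst (\<beta> c) \<noteq> M" if "c \<in> \<mu> ` I'"
        using that False \<beta> c by (auto simp: D_def)
      then have "t c = u c" using c by (auto simp: t_def D_def)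
      then show "V' c b1 = u c" using V'_t[of c] c D_sub by auto
    qed simp
    finally have "(\<Sum>c\<in>C - {c0}. V' c b1) =
        (1 + (\<Sum>c\<in>D. u c)) + (\<Sum>c\<in>C - {c0, \<mu> b1} - D. V' c b1)" using sum by simp
    \<comment> \<open>Below the top level the correction carries the factor
      \<open>p ^ (M - fst c)\<close> with positive exponent, or is 0.\<close>
    moreover have "int p dvd (\<Sum>c\<in>C - {c0, \<mu> b1} - D. V' c b1)"
    proof (rule dvd_sum)
      fix c assume c: "c \<in> C - {c0, \<mu> b1} - D"
      then have "fst c < M" using c0(2)[of c] by (auto simp: D_def M_def less_le)
      then have "int p dvd t c" by (auto simp: t_def intro!: dvd_mult dvd_power)
      then show "int p dvd V' c b1" using V'_t[of c] c by simp
    qed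
    ultimately have "\<not> int p dvd (\<Sum>c\<in>C - {c0}. V' c b1)"
      using u_sum False by (simp add: dvd_add_left_iff)
    then show ?thesis using b1 I' by (intro bexI[of _ b1]) (auto simp: M_def)
  qed
  have ord_V: "ord (E (V c)) = p ^ fst c" if c: "c \<in> C" for c
  proof (rule ordI)
    show "1 \<le> fst c" using c by (auto simp: C_def)
    show "int p ^ fst q dvd int p ^ fst c * V c q" for q
    proof (cases "c = c0")
      case True
      have "int p ^ fst q dvd int p ^ M * V' c' q" if c': "c' \<in> C - {c0}" for c'
      proof -
        have "int p ^ fst c' dvd int p ^ M" using c0(2)[of c'] c' by (auto simp: M_def intro: le_imp_power_dvd)
        then have "int p ^ fst c' * V' c' q dvd int p ^ M * V' c' q" by (intro mult_dvd_mono) auto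
        then show ?thesis using V'_kill[of c' q] c' by (auto intro: dvd_trans)
      qed
      then have "int p ^ fst q dvd (\<Sum>c'\<in>C - {c0}. int p ^ M * V' c' q)" by (rule dvd_sum)
      then show ?thesis using True by (simp add: V_def M_def sum_distrib_left)
    next
      case False
      then show ?thesis using V'_kill[OF c] by (simp add: V_def)
    qed
    show "\<exists>q\<in>I. \<not> int p ^ fst q dvd int p ^ (fst c - 1) * V c q"
    proof (cases "c = c0")
      case True
      obtain b where b: "b \<in> I" "fst b = M" "\<not> int p dvd (\<Sum>c\<in>C - {c0}. V' c b)"
        using sum_alive by blast
      then have "\<not> int p dvd V c b" using True by (simp add: V_def)
      then show ?thesis using not_dvd[of "V c b" M] M b True by (intro bexI[of _ b]) (auto simp: M_def)
    next
      case False
      then show ?thesis using V'_alive[OF c] by (simp add: V_def)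
    qed
  qed
  define AB where "AB = GenA ` {1..h} \<union> GenB ` {1..h}"
  have "card AB = 2 * h"
    unfolding AB_def by (subst card_Un_disjoint) (auto simp: card_image inj_on_def)
  then obtain \<gamma> where \<gamma>: "inj_on \<gamma> (I - I')" "\<gamma> ` (I - I') \<subseteq> AB"
    using card_le_inj[of "I - I'" AB] I' fin by (auto simp: AB_def)
  \<comment> \<open>A handle outside the range of \<gamma> receives an unspecified basis vector.
    This is harmless, since handles enter neither the order conditions nor the product
    relation.\<close>
  define f where "f s = (case s of GenC i k \<Rightarrow> V (i, k) | _ \<Rightarrow> basis (inv_into (I - I') \<gamma> s))" for s
  let ?S = "Gamma_generators e (x, h)"
  have "realizes (x, h) f"
  proof (rule realizesI)
    show "ord (E (f (GenC i k))) = p ^ i" if "i \<in> {1..e}" "k \<in> {1..x i}" for i k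
      using ord_V[of "(i, k)"] that by (simp add: f_def C_def)
    show "(\<Sum>c\<in>(SIGMA i:{1..e}. {1..x i}). f (GenC (fst c) (snd c)) q) = 0" for q
    proof -
      have "(\<Sum>c\<in>C. f (GenC (fst c) (snd c)) q) = (\<Sum>c\<in>C. V c q)" by (simp add: f_def)
      also have "\<dots> = V c0 q + (\<Sum>c\<in>C - {c0}. V c q)" using fin c0 by (intro sum.remove)
      also have "(\<Sum>c\<in>C - {c0}. V c q) = (\<Sum>c\<in>C - {c0}. V' c q)"
        by (rule sum.cong) (auto simp: V_def)
      finally show ?thesis by (simp add: V_def C_def)
    qed
    have comb_V': "combination f ?S (V' (\<mu> b))" if "b \<in> I'" for b
    proof -
      obtain i k where ik: "\<mu> b = (i, k)" by force
      have *: "\<mu> b \<in> C" "\<mu> b \<noteq> c0" using \<mu>(2) that by auto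
      then have "GenC i k \<in> ?S" by (simp add: Gamma_generators_c_iff ik C_def)
      then have "combination f ?S (f (GenC i k))" by (intro combination_generator) simp
      moreover have "f (GenC i k) = V' (\<mu> b)" using * by (auto simp: f_def V_def ik fun_eq_iff)
      ultimately show ?thesis by simp
    qed
    have comb_b1: "combination f ?S (basis b1)"
    proof -
      have "V' (\<mu> b1) = basis b1"
        using b1 \<beta> \<mu>b1 by (auto simp: V'_def t_def M_def fun_eq_iff)
      then show ?thesis using comb_V'[OF b1(1)] by simp
    qed
    show "combination f ?S (basis b)" if "b \<in> (SIGMA i:{1..e}. {1..r i})" for b
    proof (cases "b \<in> I'")
      case True
      \<comment> \<open>The order correction is undone by subtracting its multiple of
        \<open>basis b1\<close>.\<close>
      have "combination f ?S (\<lambda>q. V' (\<mu> b) q + (- t (\<mu> b)) * basis b1 q)"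
        by (intro combination_scaled_add comb_V' comb_b1 True)
      moreover have "(\<lambda>q. V' (\<mu> b) q + (- t (\<mu> b)) * basis b1 q) = basis b"
        using True \<beta> by (auto simp: V'_def fun_eq_iff)
      ultimately show ?thesis by simp
    next
      case False
      then have b: "b \<in> I - I'" using that by (simp add: I_def)
      then have *: "\<gamma> b \<in> AB" using \<gamma>(2) by blast
      then have "\<gamma> b \<in> ?S" by (simp add: AB_def Gamma_generators_eq)
      then have "combination f ?S (f (\<gamma> b))" by (intro combination_generator) simp
      moreover have "f (\<gamma> b) = basis (inv_into (I - I') \<gamma> (\<gamma> b))"
        using * by (auto simp: AB_def f_def)
      moreover have "inv_into (I - I') \<gamma> (\<gamma> b) = b"
        using \<gamma>(1) b by (rule inv_into_f_f)
      ultimately show ?thesis by simp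
    qed
  qed
  then show ?thesis by blast
qed

end

section \<open>Realizability of the minimal data and of the data with prescribed gap\<close>

context abelian_coordinates
begin

text \<open>The matching construction needs a spare \<open>c0\<close>. Without any c the product
  relation is empty, and the handles alone carry the whole basis.\<close>

lemma realizes_hyperbolic:
  assumes "\<And>i. i \<in> {1..e} \<Longrightarrow> x i = 0" and "(\<Sum>i=1..e. r i) \<le> 2 * h"
  shows "\<exists>f. realizes (x, h) f"
proof -
  define I where "I = (SIGMA i:{1..e}. {1..r i})"
  define AB where "AB = GenA ` {1..h} \<union> GenB ` {1..h}"
  have "card AB = 2 * h"
    unfolding AB_def by (subst card_Un_disjoint) (auto simp: card_image inj_on_def)
  moreover have "card I = (\<Sum>i=1..e. r i)" "finite I" by (simp_all add: I_def)
  ultimately obtain \<gamma> where \<gamma>: "inj_on \<gamma> I" "\<gamma> ` I \<subseteq> AB"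
    using card_le_inj[of I AB] assms(2) by (auto simp: AB_def)
  have no_c: "(SIGMA i:{1..e}. {1..x i}) = {}" using assms(1) by auto
  have "realizes (x, h) (\<lambda>s. basis (inv_into I \<gamma> s))"
  proof (rule realizesI)
    fix b assume "b \<in> (SIGMA i:{1..e}. {1..r i})"
    then have b: "b \<in> I" by (simp add: I_def)
    then have "\<gamma> b \<in> Gamma_generators e (x, h)"
      using \<gamma>(2) by (auto simp: AB_def Gamma_generators_eq)
    then have "combination (\<lambda>s. basis (inv_into I \<gamma> s)) (Gamma_generators e (x, h)) (basis (inv_into I \<gamma> (\<gamma> b)))"
      by (intro combination_generator[of _ "\<gamma> b"]) simp
    then show "combination (\<lambda>s. basis (inv_into I \<gamma> s)) (Gamma_generators e (x, h)) (basis b)"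
      using \<gamma>(1) b by simp
  qed (use assms(1) no_c in simp_all)
  then show ?thesis by (rule exI[of _ "\<lambda>s. basis (inv_into I \<gamma> s)"])
qed

text \<open>The matching is the identity on the factors up to level \<open>m\<close>, with the
  additional c at level \<open>m\<close> as the spare one. If \<open>r m = 1\<close> then
  \<open>x m = 2\<close> is even; otherwise a second basis element of level \<open>m\<close>
  exists.\<close>

lemma minimal_datum_in_data_spectrum:
  assumes m: "m \<le> e" and r: "\<And>l. l \<in> {m+1..e} \<Longrightarrow> r l = p - 1"
    and ev: "even ((e - m) * (p - 1))" and r_pos: "\<And>i. i \<in> {1..e} \<Longrightarrow> 1 \<le> r i"
  shows "minimal_datum p e r m \<in> data_spectrum p e G"
proof -
  obtain x h where xh: "minimal_datum p e r m = (x, h)" by force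
  then have x: "x l = (if 1 \<le> l \<and> l < m then r l else if 1 \<le> l \<and> l = m then r m + 1 else 0)" for l
    by (auto simp: minimal_datum_def)
  have h: "2 * h = (e - m) * (p - 1)" using ev xh by (auto simp: minimal_datum_def)
  have R: "(\<Sum>l=m+1..e. r l) = 2 * h" using r h by simp
  have "\<exists>f. realizes (x, h) f"
  proof (cases "m = 0")
    case True
    then show ?thesis using R by (intro realizes_hyperbolic) (auto simp: x)
  next
    case False
    define I where "I = (SIGMA i:{1..e}. {1..r i})"
    define I' where "I' = {b \<in> I. fst b \<le> m}"
    have "I - I' = (SIGMA i:{m+1..e}. {1..r i})" by (auto simp: I_def I'_def)
    then have "card (I - I') = 2 * h" using R by simp
    show ?thesis
    proof (rule realizes_of_matching[where I' = I' and \<mu> = id and ?c0.0 = "(m, r m + 1)" and ?b1.0 = "(m, 1)"])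
      show "I' \<subseteq> (SIGMA i:{1..e}. {1..r i})" by (auto simp: I'_def I_def)
      show "card ((SIGMA i:{1..e}. {1..r i}) - I') \<le> 2 * h"
        using \<open>card (I - I') = 2 * h\<close> by (simp add: I_def)
      show "(m, r m + 1) \<in> (SIGMA i:{1..e}. {1..x i})" using m False by (auto simp: x)
      show "fst c \<le> fst (m, r m + 1)" if "c \<in> (SIGMA i:{1..e}. {1..x i})" for c
        using that by (auto simp: x split: if_splits)
      show "(m, 1) \<in> I'" using r_pos[of m] m False by (auto simp: I'_def I_def)
      show "id ` I' \<subseteq> (SIGMA i:{1..e}. {1..x i}) - {(m, r m + 1)}"
        by (auto simp: I'_def I_def x)
      show "(\<exists>b2\<in>I'. b2 \<noteq> (m, 1) \<and> fst b2 = fst (m, r m + 1)) \<or> odd p \<or> even (x (fst (m, r m + 1)))"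
      proof (cases "r m = 1")
        case True
        then show ?thesis using False by (simp add: x)
      next
        case False
        then have "(m, 2) \<in> I'" using r_pos[of m] m \<open>m \<noteq> 0\<close> by (auto simp: I'_def I_def)
        then show ?thesis by (intro disjI1 bexI[of _ "(m, 2)"]) auto
      qed
    qed auto
  qed
  moreover have "\<forall>i. i \<notin> {1..e} \<longrightarrow> x i = 0" using m by (auto simp: x)
  ultimately show ?thesis by (simp add: data_spectrum_iff xh)
qed

text \<open>Giving \<open>2h\<close> top-level basis elements to the handles and setting one
  top-level c aside turns the tail inequalities into the counting condition of
  \<open>level_matching\<close>.\<close>

lemma datum_in_data_spectrum:
  assumes x_out: "\<forall>i. i \<notin> {1..e} \<longrightarrow> x i = 0"
    and h: "2 * h < r e" "p = 2 \<longrightarrow> h = 0" and x_e: "2 \<le> x e" "p = 2 \<and> r e = 1 \<longrightarrow> even (x e)"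
    and tails: "\<forall>i\<in>{1..e}. (\<Sum>l=i..e. r l) + 1 \<le> 2 * h + (\<Sum>l=i..e. x l)"
  shows "(x, h) \<in> data_spectrum p e G"
proof -
  define I where "I = (SIGMA i:{1..e}. {1..r i})"
  define C where "C = (SIGMA i:{1..e}. {1..x i})"
  \<comment> \<open>Taken at level \<open>e\<close>, these elements lower the count for every
    threshold \<open>i \<le> e\<close> by the full \<open>2h\<close>. Taking the last ones keeps
    \<open>(e, 1)\<close> free as \<open>b1\<close>.\<close>
  define K where "K = Pair e ` {r e - 2 * h<..r e}"
  have fin: "finite I" "finite C" "finite K" by (auto simp: I_def C_def K_def)
  have K: "K \<subseteq> I" "card K = 2 * h"
    using e_pos h(1) by (auto simp: K_def I_def card_image inj_on_def)
  have c0: "(e, 1) \<in> C" using e_pos x_e by (auto simp: C_def)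
  have "card {b \<in> I - K. i \<le> fst b} \<le> card {c \<in> C - {(e, 1)}. i \<le> fst c}" for i
  proof (cases "i \<le> e")
    case True
    \<comment> \<open>Threshold 0 imposes the same condition as threshold 1, where the tail
      inequalities begin.\<close>
    define i' where "i' = max i 1"
    have i': "i' \<in> {1..e}" using True e_pos by (auto simp: i'_def)
    have "{b \<in> I. i \<le> fst b} = (SIGMA l:{i'..e}. {1..r l})" "{c \<in> C. i \<le> fst c} = (SIGMA l:{i'..e}. {1..x l})"
      by (auto simp: I_def C_def i'_def)
    then have cards: "card {b \<in> I. i \<le> fst b} = (\<Sum>l=i'..e. r l)" "card {c \<in> C. i \<le> fst c} = (\<Sum>l=i'..e. x l)"
      by simp_all
    have "K \<subseteq> {b \<in> I. i \<le> fst b}" using K(1) True by (auto simp: K_def)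
    moreover have "{b \<in> I - K. i \<le> fst b} = {b \<in> I. i \<le> fst b} - K" by auto
    ultimately have "card {b \<in> I - K. i \<le> fst b} = (\<Sum>l=i'..e. r l) - 2 * h"
      using fin K(2) cards by (simp add: card_Diff_subset)
    moreover have "{c \<in> C - {(e, 1)}. i \<le> fst c} = {c \<in> C. i \<le> fst c} - {(e, 1)}" by auto
    then have "card {c \<in> C - {(e, 1)}. i \<le> fst c} = (\<Sum>l=i'..e. x l) - 1"
      using c0 True cards by (simp add: card_Diff_singleton)
    ultimately show ?thesis using bspec[OF tails i'] by linarith
  next
    case False
    then have "{b \<in> I - K. i \<le> fst b} = {}" by (auto simp: I_def)
    then show ?thesis by (metis card.empty zero_le)
  qed
  then obtain \<mu> where \<mu>: "inj_on \<mu> (I - K)" "\<mu> ` (I - K) \<subseteq> C - {(e, 1)}" "\<forall>b\<in>I - K. fst b \<le> fst (\<mu> b)"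
    using level_matching[of "I - K" "C - {(e, 1)}" fst fst] fin by auto
  have "\<exists>f. realizes (x, h) f"
  proof (rule realizes_of_matching[where I' = "I - K" and \<mu> = \<mu> and ?c0.0 = "(e, 1)" and ?b1.0 = "(e, 1)"])
    show "I - K \<subseteq> (SIGMA i:{1..e}. {1..r i})" by (auto simp: I_def)
    have "I - (I - K) = K" using K(1) by auto
    then show "card ((SIGMA i:{1..e}. {1..r i}) - (I - K)) \<le> 2 * h"
      using K(2) by (simp add: I_def)
    show "(e, 1) \<in> I - K" using e_pos h(1) by (auto simp: I_def K_def)
    show "(\<exists>b2\<in>I - K. b2 \<noteq> (e, 1) \<and> fst b2 = fst (e, 1::nat)) \<or> odd p \<or> even (x (fst (e, 1::nat)))"
    proof (cases "2 \<le> r e - 2 * h")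
      case True
      then have "(e, 2) \<in> I - K" using e_pos by (auto simp: I_def K_def)
      then show ?thesis by (intro disjI1 bexI[of _ "(e, 2)"]) auto
    next
      case False
      show ?thesis
      proof (cases "p = 2")
        case True
        \<comment> \<open>For \<open>p = 2\<close> there are no handles, so a single remaining top
          element means \<open>r e = 1\<close>, and then \<open>x e\<close> is even.\<close>
        then show ?thesis using False h x_e(2) by auto
      next
        case False
        then have "odd p" using prime_odd_nat[OF prime_p] prime_ge_2_nat[OF prime_p] by simp
        then show ?thesis by simp
      qed
    qed
  qed (use \<mu> c0 in \<open>auto simp: C_def\<close>)
  then show ?thesis using x_out by (simp add: data_spectrum_iff)
qed

section \<open>The invariant epsilon\<close>

lemma E_pow_exponent: "E v [^] (p ^ e) = \<one>"
proof -
  have "E (\<lambda>q. int (p ^ e) * v q) = \<one>"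
    unfolding E_eq_one_iff by (auto intro!: dvd_mult2 le_imp_power_dvd)
  then show ?thesis by (simp only: E_pow)
qed

lemma group_exponent_eq:
  assumes "1 \<le> r e"
  shows "group_exponent G = p ^ e"
  unfolding group_exponent_def
proof (rule Least_equality)
  show "0 < p ^ e \<and> (\<forall>a\<in>carrier G. a [^] (p ^ e) = \<one>)"
  proof (intro conjI ballI)
    show "0 < p ^ e" using prime_gt_0_nat[OF prime_p] by simp
    fix a assume "a \<in> carrier G"
    then obtain v where "a = E v" using E_surj by blast
    then show "a [^] (p ^ e) = \<one>" using E_pow_exponent by simp
  qed
next
  fix n :: nat assume n: "0 < n \<and> (\<forall>a\<in>carrier G. a [^] n = \<one>)"
  then have "E (\<lambda>q. int n * basis (e, 1) q) = \<one>" unfolding E_pow by simp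
  then have "int p ^ e dvd int n * basis (e, 1) (e, 1)"
    using e_pos assms unfolding E_eq_one_iff by auto
  then have "p ^ e dvd n" by (simp add: basis_def flip: of_nat_power)
  then show "p ^ e \<le> n" using n by (auto intro: dvd_imp_le)
qed

text \<open>The power \<open>p ^ (e - 1)\<close> kills every factor of smaller order, so only
  coordinates at level \<open>e\<close> can produce an element of order
  \<open>p ^ e\<close>.\<close>

lemma ord_less_exponent_iff: "ord (E v) < p ^ e \<longleftrightarrow> (\<forall>k\<in>{1..r e}. int p dvd v (e, k))"
proof -
  have "ord (E v) dvd p ^ e" using E_pow_exponent pow_eq_id[of "E v" "p ^ e"] by simp
  then have "ord (E v) \<le> p ^ e" using prime_gt_0_nat[OF prime_p] by (auto intro: dvd_imp_le)
  then have "ord (E v) < p ^ e \<longleftrightarrow> ord (E v) \<noteq> p ^ e" by auto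
  also have "\<dots> \<longleftrightarrow> (\<forall>i\<in>{1..e}. \<forall>k\<in>{1..r i}. int p ^ i dvd int p ^ (e - 1) * v (i, k))"
  proof -
    have "\<forall>i\<in>{1..e}. \<forall>k\<in>{1..r i}. int p ^ i dvd int p ^ e * v (i, k)"
      by (auto intro!: dvd_mult2 le_imp_power_dvd)
    then show ?thesis unfolding ord_E_iff[OF e_pos] by blast
  qed
  also have "\<dots> \<longleftrightarrow> (\<forall>k\<in>{1..r e}. int p ^ e dvd int p ^ (e - 1) * v (e, k))"
  proof
    assume *: "\<forall>k\<in>{1..r e}. int p ^ e dvd int p ^ (e - 1) * v (e, k)"
    show "\<forall>i\<in>{1..e}. \<forall>k\<in>{1..r i}. int p ^ i dvd int p ^ (e - 1) * v (i, k)"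
    proof (intro ballI)
      fix i k assume "i \<in> {1..e}" "k \<in> {1..r i}"
      then show "int p ^ i dvd int p ^ (e - 1) * v (i, k)"
        using * by (cases "i = e") (auto intro!: dvd_mult2 le_imp_power_dvd)
    qed
  qed (use e_pos in auto)
  also have "\<dots> \<longleftrightarrow> (\<forall>k\<in>{1..r e}. int p dvd v (e, k))"
  proof -
    have "int p ^ e = int p ^ (e - 1) * int p" using e_pos by (metis power_minus_mult Suc_le_eq One_nat_def)
    then show ?thesis using prime_gt_0_nat[OF prime_p] by simp
  qed
  finally show ?thesis .
qed

text \<open>The elements of order below the exponent form the kernel of reducing the
  level-\<open>e\<close> coordinates modulo \<open>p\<close>. The quotient is elementary abelian of
  rank \<open>r e\<close>, so for \<open>p = 2\<close> the index is 2 exactly if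
  \<open>r e = 1\<close>.\<close>

lemma group_epsilon_eq:
  assumes "1 \<le> r e"
  shows "group_epsilon p G = (if odd p \<or> r e = 1 then 1 else 2)"
proof -
  define H where "H = {a \<in> carrier G. ord a < group_exponent G}"
  have E_mem: "E v \<in> H \<longleftrightarrow> (\<forall>k\<in>{1..r e}. int p dvd v (e, k))" for v
    using ord_less_exponent_iff[of v] by (simp add: H_def group_exponent_eq[OF assms])
  have H: "subgroup H G"
  proof (rule subgroupI)
    show "H \<subseteq> carrier G" by (auto simp: H_def)
    have "E (\<lambda>q. 0) \<in> H" unfolding E_mem by simp
    then show "H \<noteq> {}" by blast
  next
    fix a assume a: "a \<in> H"
    then obtain v where v: "a = E v" using E_surj by (auto simp: H_def)
    have "E (\<lambda>q. - v q) \<in> H" using a unfolding v E_mem by simp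
    then show "inv a \<in> H" by (simp add: v E_uminus)
  next
    fix a b assume ab: "a \<in> H" "b \<in> H"
    then obtain v w where v: "a = E v" "b = E w" using E_surj by (auto simp: H_def) metis
    have "E (\<lambda>q. v q + w q) \<in> H" using ab unfolding v E_mem by simp
    then show "a \<otimes> b \<in> H" by (simp add: v E_add)
  qed
  have coset_eq: "H #> E v = H #> E w \<longleftrightarrow> (\<forall>k\<in>{1..r e}. int p dvd v (e, k) - w (e, k))" for v w
  proof -
    have "H #> E v = H #> E w \<longleftrightarrow> E v \<in> H #> E w"
      using repr_independence[OF _ _ H, of "E v" "E w"] rcos_self[OF _ H, of "E v"] by auto
    also have "\<dots> \<longleftrightarrow> E v \<otimes> inv E w \<in> H"
      by (rule subgroup.rcos_module[OF H is_group]) simp_all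
    also have "E v \<otimes> inv E w = E (\<lambda>q. v q + - w q)" by (simp only: E_add E_uminus)
    finally show ?thesis unfolding E_mem by simp
  qed
  have rcosets: "rcosets H = range (\<lambda>v. H #> E v)"
  proof
    show "rcosets H \<subseteq> range (\<lambda>v. H #> E v)"
    proof
      fix X assume "X \<in> rcosets H"
      then obtain a where a: "a \<in> carrier G" "X = H #> a" by (auto simp: RCOSETS_def)
      from E_surj[OF a(1)] obtain v where "a = E v" by blast
      with a show "X \<in> range (\<lambda>v. H #> E v)" by blast
    qed
    show "range (\<lambda>v. H #> E v) \<subseteq> rcosets H" unfolding RCOSETS_def using E_closed by blast
  qed
  have "card (rcosets H) = 2 \<longleftrightarrow> r e = 1" if p2: "p = 2"
  proof (cases "r e = 1")
    case True
    have "H #> E v \<in> {H #> E (\<lambda>q. 0), H #> E (basis (e, 1))}" for v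
      by (cases "even (v (e, 1))") (simp_all add: coset_eq True p2 basis_def del: E_zero)
    then have "rcosets H = {H #> E (\<lambda>q. 0), H #> E (basis (e, 1))}"
      unfolding rcosets by blast
    moreover have "H #> E (\<lambda>q. 0) \<noteq> H #> E (basis (e, 1))"
      unfolding coset_eq by (simp add: True p2 basis_def)
    ultimately show ?thesis using True by simp
  next
    case False
    then have r2: "2 \<le> r e" using assms by simp
    \<comment> \<open>Three distinct cosets already exclude index 2; for an infinite set of cosets
      \<open>card\<close> would be 0.\<close>
    let ?X = "{H #> E (\<lambda>q. 0), H #> E (basis (e, 1)), H #> E (basis (e, 2))}"
    have "H #> E (\<lambda>q. 0) \<noteq> H #> E (basis (e, 1))" "H #> E (\<lambda>q. 0) \<noteq> H #> E (basis (e, 2))"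
      "H #> E (basis (e, 1)) \<noteq> H #> E (basis (e, 2))"
      unfolding coset_eq using r2 p2
      by (auto simp: basis_def intro!: bexI[of _ 1] bexI[of _ 2])
    then have "card ?X = 3" by simp
    moreover have "?X \<subseteq> rcosets H" unfolding rcosets by blast
    ultimately have "card (rcosets H) \<noteq> 2"
      using card_mono[of "rcosets H" ?X] card.infinite[of "rcosets H"] by fastforce
    then show ?thesis using False by simp
  qed
  moreover have "p = 2" if "even p"
    using that prime_odd_nat[OF prime_p] prime_ge_2_nat[OF prime_p] by fastforce
  ultimately show ?thesis using H by (auto simp: group_epsilon_def Let_def H_def)
qed

end

section \<open>Minimum, stable upper genus and the data affording them\<close>

theorem mainTheorem1:
  fixes G :: "('g, 'm) monoid_scheme" and p e j :: nat and r :: "nat \<Rightarrow> nat"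
  assumes p: "prime p" and e: "1 \<le> e"
    and G: "comm_group G"
    and G_iso: "G \<cong> sum_group (SIGMA i:{1..e}. {1..r i}) (\<lambda>(i, k). integer_mod_group (p ^ i))"
    and r_less: "\<And>i. 1 \<le> i \<Longrightarrow> i \<le> e - 1 \<Longrightarrow> p - 1 \<le> r i"
    and r_e: "max (p - 2) 1 \<le> r e"
    and j: "j = (LEAST j. j \<le> e \<and> (\<forall>i\<in>{j+1..e}. r i = p - 1))"
    and action_correspondence: "reduced_spectrum G = reduced_genus p e ` data_spectrum p e G"
  shows
    "reduced_minimum_genus G =
       1 / 2 * (- 1 - of_nat p ^ e + (\<Sum>i = 1..e. (of_nat p ^ e - of_nat p ^ (e - i)) * of_nat (r i)))
     \<and> reduced_stable_upper_genus p G =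
       1 / 2 * (- 1 - of_nat p ^ e + (\<Sum>i = 1..e. (of_nat p ^ e - of_nat p ^ (e - i)) * of_nat (r i)))
     \<and> {d \<in> data_spectrum p e G. reduced_genus p e d = reduced_minimum_genus G} =
       {((\<lambda>k. if 1 \<le> k \<and> k < i then r k else if 1 \<le> k \<and> k = i then r i + 1 else 0),
         (e - i) * (p - 1) div 2) | i. j \<le> i \<and> i \<le> e \<and> (p = 2 \<longrightarrow> even (e - i))}
     \<and> ((\<lambda>k. if 1 \<le> k \<and> k < e then r k else if k = e then r e + 1 else 0), 0)
         \<in> {d \<in> data_spectrum p e G. reduced_genus p e d = reduced_minimum_genus G}"
proof -
  obtain E where E: "abelian_coordinates G p e r E"
    using abelian_coordinates_exist[OF p e G G_iso] by (elim exE)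
  interpret abelian_coordinates G p e r E by (rule E)
  define \<mu> :: rat where "\<mu> = 1 / 2 * (- 1 - of_nat p ^ e +
    (\<Sum>i = 1..e. (of_nat p ^ e - of_nat p ^ (e - i)) * of_nat (r i)))"
  have p2: "2 \<le> p" using p by (rule prime_ge_2_nat)
  have odd_p: "odd p" if "p \<noteq> 2" using that p2 prime_odd_nat[OF p] by simp
  have r_pos: "1 \<le> r i" if "i \<in> {1..e}" for i
  proof (cases "i = e")
    case False
    with that have "i < e" by simp
    then have "p - 1 \<le> r i" using r_less[of i] that by auto
    then show ?thesis using p2 by linarith
  qed (use r_e in simp)
  have genus: "reduced_genus p e d = \<mu> + of_int (gap p e r d) / 2" for d
    unfolding \<mu>_def by (rule reduced_genus_eq_gap)
  have gap_cases: "gap p e r d \<ge> 0 \<and> (gap p e r d = 0 \<longrightarrow>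
      (\<exists>m\<le>e. (\<forall>l\<in>{m+1..e}. r l = p - 1) \<and> even ((e - m) * (p - 1)) \<and> d = minimal_datum p e r m))"
    if d_in: "d \<in> data_spectrum p e G" for d
  proof -
    obtain x h where d: "d = (x, h)" by force
    obtain f where f: "realizes (x, h) f" and x_out: "\<forall>i. i \<notin> {1..e} \<longrightarrow> x i = 0"
      using d_in unfolding d data_spectrum_iff by auto
    show ?thesis unfolding d
      by (rule gap_nonneg_and_zero_cases[OF p e r_less r_e rank_bound[OF f]]) (use x_out in auto)
  qed
  have minimal: "minimal_datum p e r m \<in> data_spectrum p e G" "gap p e r (minimal_datum p e r m) = 0"
    if "m \<le> e" "\<forall>l\<in>{m+1..e}. r l = p - 1" "even ((e - m) * (p - 1))" for m
    using that r_pos p2 by (auto intro!: minimal_datum_in_data_spectrum gap_minimal_datum)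
  have top: "minimal_datum p e r e \<in> data_spectrum p e G" "gap p e r (minimal_datum p e r e) = 0"
    using minimal[of e] by simp_all
  have min_genus: "reduced_minimum_genus G = \<mu>"
    unfolding reduced_minimum_genus_def action_correspondence
  proof (rule Least_equality)
    show "\<mu> \<in> reduced_genus p e ` data_spectrum p e G"
      using top by (intro image_eqI[of _ _ "minimal_datum p e r e"]) (simp_all add: genus)
    show "\<mu> \<le> s" if "s \<in> reduced_genus p e ` data_spectrum p e G" for s
      using that gap_cases by (auto simp: genus)
  qed
  have attained: "\<mu> + of_nat N / 2 \<in> reduced_spectrum G"
    if N: "odd p \<or> r e = 1 \<Longrightarrow> even N" for N
  proof -
    obtain x h where xh: "gap p e r (x, h) = int N" "\<forall>i. i \<notin> {1..e} \<longrightarrow> x i = 0"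
      "2 * h < r e" "2 \<le> x e" "p = 2 \<longrightarrow> h = 0" "p = 2 \<and> r e = 1 \<longrightarrow> even (x e)"
      "\<forall>i\<in>{1..e}. (\<Sum>l=i..e. r l) + 1 \<le> 2 * h + (\<Sum>l=i..e. x l)"
      using datum_with_gap[of p e r N, OF p e r_less r_e N] by blast
    have "(x, h) \<in> data_spectrum p e G" using xh by (intro datum_in_data_spectrum)
    moreover have "reduced_genus p e (x, h) = \<mu> + of_nat N / 2" by (simp add: genus xh(1))
    ultimately show ?thesis unfolding action_correspondence by force
  qed
  \<comment> \<open>Twice \<mu> as an integer; its parity decides whether \<mu> lies in the lattice
    of possible reduced genera.\<close>
  define K :: int where "K = - 1 - int p ^ e + (\<Sum>i = 1..e. (int p ^ e - int p ^ (e - i)) * int (r i))"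
  have \<mu>_K: "\<mu> = of_int K / 2" by (simp add: \<mu>_def K_def)
  have weight_nonneg: "0 \<le> (int p ^ e - int p ^ (e - i)) * int (r i)" for i
    using p2 by (simp add: power_increasing)
  \<comment> \<open>The top-level summand alone suffices for the lower bounds on \<mu> that
    membership in \<open>genus_range\<close> requires.\<close>
  have "(int p ^ e - int p ^ (e - e)) * int (r e) \<le> (\<Sum>i = 1..e. (int p ^ e - int p ^ (e - i)) * int (r i))"
    using weight_nonneg e by (intro member_le_sum) auto
  then have K_ge: "- 1 - int p ^ e + (int p ^ e - 1) * int (r e) \<le> K" by (simp add: K_def)
  have p_pow: "2 \<le> int p ^ e" using self_le_power[of "int p" e] p2 e by linarith
  define \<epsilon> where "\<epsilon> = group_epsilon p G"
  have \<epsilon>: "\<epsilon> = (if odd p \<or> r e = 1 then 1 else 2)"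
    unfolding \<epsilon>_def using r_e by (intro group_epsilon_eq) simp
  have range_iff: "s \<in> genus_range p G \<longleftrightarrow> (\<exists>a\<ge>-1. s = of_int a / of_nat \<epsilon>)" for s
  proof -
    have "a \<in> {-1..} \<longleftrightarrow> a \<in> insert (- 1) (range int)" for a :: int
    proof (cases "0 \<le> a")
      case True
      then have "a = int (nat a)" by simp
      then show ?thesis using True by (metis atLeast_iff insertI2 le_minus_one_simps(1) order_trans rangeI)
    qed auto
    then have "{-1..} = insert (- 1) (range int)" by blast
    then have "({- 1} \<union> range of_nat :: rat set) = of_int ` {-1..}"
      by (simp add: image_image)
    then show ?thesis unfolding genus_range_def \<epsilon>_def [symmetric] by (auto simp: image_image)
  qed
  have K_even: "even K" if "\<epsilon> = 1"
  proof (cases "odd p")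
    case True
    then show ?thesis using e by (auto simp: K_def intro!: dvd_sum)
  next
    case False
    then have "p = 2" using odd_p by blast
    have "r e = 1"
    proof (rule ccontr)
      assume "r e \<noteq> 1"
      with False have "\<epsilon> = 2" unfolding \<epsilon> by simp
      with that show False by simp
    qed
    \<comment> \<open>For \<open>p = 2\<close> only the weight at \<open>i = e\<close> is odd; with
      \<open>r e = 1\<close> it balances the odd constant -1.\<close>
    have "{1..e} = insert e {1..<e}" using e by auto
    then have "K = - 1 - int p ^ e + ((int p ^ e - 1) * int (r e) +
        (\<Sum>i = 1..<e. (int p ^ e - int p ^ (e - i)) * int (r i)))"
      by (simp add: K_def)
    moreover have "even (\<Sum>i = 1..<e. (int p ^ e - int p ^ (e - i)) * int (r i))"
      using \<open>p = 2\<close> e by (auto intro!: dvd_sum)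
    moreover have "even (int p ^ e)" using \<open>p = 2\<close> e by simp
    ultimately show ?thesis using \<open>r e = 1\<close> by simp
  qed
  have \<mu>_range: "\<mu> \<in> genus_range p G"
  proof (cases "\<epsilon> = 1")
    case True
    have "int p ^ e - 1 \<le> (int p ^ e - 1) * int (r e)"
      using mult_left_mono[of 1 "int (r e)" "int p ^ e - 1"] p_pow r_e by simp
    then have "- 1 \<le> K div 2" using K_ge by linarith
    moreover have "\<mu> = of_int (K div 2) / of_nat \<epsilon>"
      using K_even True by (auto simp: \<mu>_K elim!: evenE)
    ultimately show ?thesis unfolding range_iff by blast
  next
    case False
    then have "\<not> (odd p \<or> r e = 1)" unfolding \<epsilon> by presburger
    then have "\<epsilon> = 2" "2 \<le> r e" unfolding \<epsilon> using r_e by auto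
    have "(int p ^ e - 1) * 2 \<le> (int p ^ e - 1) * int (r e)"
      using p_pow p2 \<open>2 \<le> r e\<close> by (intro mult_left_mono) auto
    \<comment> \<open>With \<open>r e \<ge> 2\<close> the bound reads
      \<open>K \<ge> p ^ e - 3\<close>, and \<open>p ^ e \<ge> 2\<close>.\<close>
    then have "- 1 \<le> K" using K_ge p_pow unfolding left_diff_distrib by linarith
    then show ?thesis unfolding range_iff using \<open>\<epsilon> = 2\<close> by (intro exI[of _ K]) (simp add: \<mu>_K)
  qed
  have above: "t \<in> reduced_spectrum G" if t: "t \<in> genus_range p G" "\<mu> \<le> t" for t
  proof -
    obtain a where a: "t = of_int a / of_nat \<epsilon>" using t(1) unfolding range_iff by blast
    \<comment> \<open>Twice \<open>t\<close>. For \<epsilon> = 1 it is even, like \<open>K\<close>,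
      so the distance from \<mu> has the parity that \<open>attained\<close> asks for.\<close>
    define b where "b = (if \<epsilon> = 1 then 2 * a else a)"
    have "\<epsilon> = 1 \<or> \<epsilon> = 2" unfolding \<epsilon> by simp
    then have tb: "t = of_int b / 2" by (auto simp: a b_def)
    then have "K \<le> b" using t(2) by (simp add: \<mu>_K)
    have "\<mu> + of_nat (nat (b - K)) / 2 \<in> reduced_spectrum G"
    proof (rule attained)
      assume "odd p \<or> r e = 1"
      then have "\<epsilon> = 1" unfolding \<epsilon> by simp
      then have "even (b - K)" using K_even by (simp add: b_def)
      then show "even (nat (b - K))" using \<open>K \<le> b\<close> by (simp add: even_nat_iff)
    qed
    moreover have "\<mu> + of_nat (nat (b - K)) / 2 = t"
      using \<open>K \<le> b\<close> by (simp add: \<mu>_K tb field_simps)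
    ultimately show ?thesis by simp
  qed
  have below: "\<mu> \<le> s" if "s \<in> reduced_spectrum G" for s
    using that gap_cases unfolding action_correspondence by (auto simp: genus)
  have stable: "reduced_stable_upper_genus p G = \<mu>"
    unfolding reduced_stable_upper_genus_def
  proof (rule Least_equality)
    show "\<mu> \<in> genus_range p G \<and> (\<forall>t\<in>genus_range p G - reduced_spectrum G. t < \<mu>)"
      using \<mu>_range above by force
    \<comment> \<open>If \<open>s\<close> were below the minimum \<mu> of the spectrum,
      \<open>s\<close> would itself be a missing value, giving \<open>s < s\<close>.\<close>
    show "\<mu> \<le> s" if "s \<in> genus_range p G \<and> (\<forall>t\<in>genus_range p G - reduced_spectrum G. t < s)" for s
      using that below by blast
  qed
  have j_spec: "j \<le> e \<and> (\<forall>i\<in>{j+1..e}. r i = p - 1)"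
    unfolding j by (rule LeastI[of _ e]) simp
  have j_le: "j \<le> m" if "m \<le> e" "\<forall>i\<in>{m+1..e}. r i = p - 1" for m
    unfolding j by (rule Least_le) (use that in simp)
  \<comment> \<open>For odd \<open>p\<close> the factor \<open>p - 1\<close> is even, and for
    \<open>p = 2\<close> it is 1. Hence the integrality of \<open>h\<close> restricts
    \<open>i\<close> only for \<open>p = 2\<close>.\<close>
  have parity: "even ((e - i) * (p - 1)) \<longleftrightarrow> (p = 2 \<longrightarrow> even (e - i))" for i
    using odd_p p2 by (cases "p = 2") auto
  have minimal_data: "{d \<in> data_spectrum p e G. reduced_genus p e d = reduced_minimum_genus G} =
      {minimal_datum p e r i | i. j \<le> i \<and> i \<le> e \<and> (p = 2 \<longrightarrow> even (e - i))}"
    (is "?L = ?R")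
  proof
    show "?L \<subseteq> ?R"
    proof
      fix d assume "d \<in> ?L"
      then have "d \<in> data_spectrum p e G" "gap p e r d = 0" by (auto simp: min_genus genus)
      then obtain m where m: "m \<le> e" "\<forall>l\<in>{m+1..e}. r l = p - 1" "even ((e - m) * (p - 1))"
          "d = minimal_datum p e r m"
        using gap_cases by blast
      then show "d \<in> ?R" using j_le[OF m(1,2)] parity by blast
    qed
    show "?R \<subseteq> ?L"
    proof
      fix d assume "d \<in> ?R"
      then obtain i where i: "d = minimal_datum p e r i" "j \<le> i" "i \<le> e" "even ((e - i) * (p - 1))"
        using parity by blast
      then have "\<forall>l\<in>{i+1..e}. r l = p - 1" using j_spec by auto
      then show "d \<in> ?L" using minimal[of i] i by (simp add: min_genus genus)
    qed
  qed
  have "minimal_datum p e r e = ((\<lambda>k. if 1 \<le> k \<and> k < e then r k else if k = e then r e + 1 else 0), 0)"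
    using e by (auto simp: minimal_datum_def fun_eq_iff)
  then have "((\<lambda>k. if 1 \<le> k \<and> k < e then r k else if k = e then r e + 1 else 0), 0)
      \<in> {d \<in> data_spectrum p e G. reduced_genus p e d = reduced_minimum_genus G}"
    using top by (simp add: min_genus genus)
  with min_genus stable minimal_data show ?thesis
    unfolding \<mu>_def minimal_datum_def by blast
qed

end
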